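(* Let $h,\lambda\in(0,\frac12]$ and $m\in[2,\infty)$. If $h\ge\lambda^{5/6}$, then $$\min_{A^{vKD}_{\lambda,1,m}}E^{vKD}_h\ \sim_m\ \lambda^2.$$ The same result holds in the case $m=\infty$ (i.e. if $h,\lambda\in(0,\frac12]$ and $h\ge\lambda^{5/6}$, then $\min_{A^{vKD}_{\lambda,1,\infty}}E^{vKD}_h\sim\lambda^2$).
   Context: Let $I_\theta=[0,2\pi]$, $I_z=[-\frac12,\frac12]$, $\Omega=I_\theta\times I_z$ with coordinates $(\theta,z)$. $H^k_{\mathrm{per}}(\Omega)$ is the space of ($\Omega$-)periodic $L^2$-based Sobolev functions of order $k$ on $\Omega$. For a displacement $\phi=(\phi_\rho,\phi_\theta,\phi_z):\Omega\to\mathbb{R}^3$ (cylindrical components), the von Kármán–Donnell strain $\epsilon$ is the symmetric $2\times2$ matrix with entries $\epsilon_{\theta\theta}=\partial_\theta\phi_\theta+\frac12(\partial_\theta\phi_\rho)^2+\phi_\rho$, $\epsilon_{zz}=\partial_z\phi_z+\frac12(\partial_z\phi_\rho)^2$, $\epsilon_{\theta z}=\frac12(\partial_\theta\phi_z+\partial_z\phi_\theta)+\frac12\partial_\theta\phi_\rho\,\partial_z\phi_\rho$. The energy is $E^{vKD}_h(\phi)=\int_\Omega |\epsilon|^2+h^2|D^2\phi_\rho|^2\,d\theta\,dz$ (Euclidean matrix norms). The admissible set $A^{vKD}_{\lambda,\varrho,m}$ consists of all $\phi:\Omega\to\mathbb{R}^3$ with $\phi_\rho\in H^2_{\mathrm{per}}(\Omega)$,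 $\phi_\theta\in H^1_{\mathrm{per}}(\Omega)$, $\phi_z+\lambda z\in H^1_{\mathrm{per}}(\Omega)$, $\phi_\rho\ge\varrho-1$, and $\max_{i\in\{\theta,z\},\,j\in\{\rho,\theta,z\}}\|\partial_i\phi_j\|_{L^\infty(\Omega)}\le m$ (no constraint if $m=\infty$); here $\varrho=1$. $\min_A E$ denotes the minimum energy value, i.e. the infimum of $E$ over $A$. $X\lesssim Y$ (resp. $X\lesssim_a Y$) means $X\le CY$ with $C>0$ a numerical constant (resp. depending only on $a$); $X\sim Y$ (resp. $X\sim_a Y$) means both $X\lesssim Y$ and $Y\lesssim X$ (resp. with $\lesssim_a$). *)

theory Defs
  imports "HOL-Analysis.Analysis" "HOL-Probability.Essential_Supremum"
begin

definition Omega :: "(real \<times> real) set" where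
  "Omega = {0..2 * pi} \<times> {-(1/2)..1/2}"

abbreviation Omega_measure :: "(real \<times> real) measure" where
  "Omega_measure \<equiv> restrict_space lborel Omega"

text \<open>
  Points of the plane are pairs \<open>(\<theta>, z)\<close>.  Functions on \<open>Omega\<close> are represented by total
  functions on the plane; only their values on \<open>Omega\<close>, up to null sets, enter the definitions
  of the function spaces, the admissible set and the energy.
\<close>

section \<open>Test functions\<close>

definition pd_theta :: "(real \<times> real \<Rightarrow> real) \<Rightarrow> real \<times> real \<Rightarrow> real" where
  "pd_theta f = (\<lambda>(\<theta>, z). deriv (\<lambda>t. f (t, z)) \<theta>)"

definition pd_z :: "(real \<times> real \<Rightarrow> real) \<Rightarrow> real \<times> real \<Rightarrow> real" where
  "pd_z f = (\<lambda>(\<theta>, z). deriv (\<lambda>t. f (\<theta>, t)) z)"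

definition pd :: "nat \<Rightarrow> nat \<Rightarrow> (real \<times> real \<Rightarrow> real) \<Rightarrow> real \<times> real \<Rightarrow> real" where
  "pd i j f = (pd_theta ^^ i) ((pd_z ^^ j) f)"

text \<open>
  Total (Frechet) differentiability of every \<open>pd i j f\<close> makes all of them continuous and makes
  mixed partial derivatives commute, so this is the class of infinitely differentiable functions.
\<close>

definition smooth :: "(real \<times> real \<Rightarrow> real) \<Rightarrow> bool" where
  "smooth f \<longleftrightarrow> (\<forall>i j. pd i j f differentiable_on UNIV)"

definition Omega_periodic :: "(real \<times> real \<Rightarrow> real) \<Rightarrow> bool" where
  "Omega_periodic f \<longleftrightarrow>
     (\<forall>\<theta> z. f (\<theta> + 2 * pi, z) = f (\<theta>, z) \<and> f (\<theta>, z + 1) = f (\<theta>, z))"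

definition per_tests :: "(real \<times> real \<Rightarrow> real) set" where
  "per_tests = {\<psi>. smooth \<psi> \<and> Omega_periodic \<psi>}"

text \<open>
  Since \<open>Omega\<close> is bounded, the support below is automatically compact.
\<close>

definition interior_tests :: "(real \<times> real \<Rightarrow> real) set" where
  "interior_tests = {\<psi>. smooth \<psi> \<and> closure {x. \<psi> x \<noteq> 0} \<subseteq> interior Omega}"

section \<open>Weak derivatives and function spaces\<close>

definition L2 :: "(real \<times> real \<Rightarrow> real) set" where
  "L2 = {f. f \<in> borel_measurable Omega_measure \<and> integrable Omega_measure (\<lambda>x. (f x)\<^sup>2)}"

definition has_weak_deriv ::
  "(real \<times> real \<Rightarrow> real) set \<Rightarrow> nat \<Rightarrow> nat \<Rightarrow> (real \<times> real \<Rightarrow> real) \<Rightarrow> (real \<times> real \<Rightarrow> real) \<Rightarrow> bool"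
  where
  "has_weak_deriv T i j f g \<longleftrightarrow>
     (\<forall>\<psi>\<in>T. (LINT x|Omega_measure. f x * pd i j \<psi> x)
            = (-1) ^ (i + j) * (LINT x|Omega_measure. g x * \<psi> x))"

text \<open>
  Testing against all smooth periodic functions, rather than only those supported in the interior
  of \<open>Omega\<close>, is what encodes periodicity: no jump across the identified sides is allowed.
\<close>

definition H_per :: "nat \<Rightarrow> (real \<times> real \<Rightarrow> real) set" where
  "H_per k = {f \<in> L2. \<forall>i j. i + j \<le> k \<longrightarrow> (\<exists>g\<in>L2. has_weak_deriv per_tests i j f g)}"

text \<open>
  The usual weak derivative on the interior of \<open>Omega\<close>, determined up to null sets when it exists
  in \<open>L2\<close>.  It also applies to the axial displacement, which is not periodic itself.
\<close>

definition weak_deriv :: "nat \<Rightarrow> nat \<Rightarrow> (real \<times> real \<Rightarrow> real) \<Rightarrow> real \<times> real \<Rightarrow> real" where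
  "weak_deriv i j f = (SOME g. g \<in> L2 \<and> has_weak_deriv interior_tests i j f g)"

abbreviation D_theta :: "(real \<times> real \<Rightarrow> real) \<Rightarrow> real \<times> real \<Rightarrow> real" where
  "D_theta \<equiv> weak_deriv 1 0"

abbreviation D_z :: "(real \<times> real \<Rightarrow> real) \<Rightarrow> real \<times> real \<Rightarrow> real" where
  "D_z \<equiv> weak_deriv 0 1"

definition Linf_norm :: "(real \<times> real \<Rightarrow> real) \<Rightarrow> ereal" where
  "Linf_norm f = esssup Omega_measure (\<lambda>x. ereal \<bar>f x\<bar>)"

section \<open>The von Karman--Donnell model\<close>

type_synonym displacement = "real \<times> real \<Rightarrow> real ^ 3"

abbreviation comp_rho :: "displacement \<Rightarrow> real \<times> real \<Rightarrow> real" where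
  "comp_rho \<phi> \<equiv> \<lambda>x. \<phi> x $ 1"

abbreviation comp_theta :: "displacement \<Rightarrow> real \<times> real \<Rightarrow> real" where
  "comp_theta \<phi> \<equiv> \<lambda>x. \<phi> x $ 2"

abbreviation comp_z :: "displacement \<Rightarrow> real \<times> real \<Rightarrow> real" where
  "comp_z \<phi> \<equiv> \<lambda>x. \<phi> x $ 3"

definition sym_matrix :: "real \<Rightarrow> real \<Rightarrow> real \<Rightarrow> real ^ 2 ^ 2" where
  "sym_matrix a b c = vector [vector [a, b], vector [b, c]]"

definition strain :: "displacement \<Rightarrow> real \<times> real \<Rightarrow> real ^ 2 ^ 2" where
  "strain \<phi> x = sym_matrix
     (D_theta (comp_theta \<phi>) x + 1/2 * (D_theta (comp_rho \<phi>) x)\<^sup>2 + comp_rho \<phi> x)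
     (1/2 * (D_theta (comp_z \<phi>) x + D_z (comp_theta \<phi>) x)
        + 1/2 * D_theta (comp_rho \<phi>) x * D_z (comp_rho \<phi>) x)
     (D_z (comp_z \<phi>) x + 1/2 * (D_z (comp_rho \<phi>) x)\<^sup>2)"

definition weak_hessian :: "(real \<times> real \<Rightarrow> real) \<Rightarrow> real \<times> real \<Rightarrow> real ^ 2 ^ 2" where
  "weak_hessian f x = sym_matrix (weak_deriv 2 0 f x) (weak_deriv 1 1 f x) (weak_deriv 0 2 f x)"

text \<open>
  The norm on \<^typ>\<open>real ^ 2 ^ 2\<close> is the Euclidean (Frobenius) matrix norm.  The energy is a
  nonnegative extended integral, so that no integrability of the integrand has to be presupposed.
\<close>

definition energy :: "real \<Rightarrow> displacement \<Rightarrow> ennreal" where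
  "energy h \<phi> =
     (\<integral>\<^sup>+ x. ennreal ((norm (strain \<phi> x))\<^sup>2 + h\<^sup>2 * (norm (weak_hessian (comp_rho \<phi>) x))\<^sup>2)
        \<partial>Omega_measure)"

definition admissible :: "real \<Rightarrow> real \<Rightarrow> ereal \<Rightarrow> displacement set" where
  "admissible lam \<rho> m = {\<phi>.
     comp_rho \<phi> \<in> H_per 2 \<and>
     comp_theta \<phi> \<in> H_per 1 \<and>
     (\<lambda>x. comp_z \<phi> x + lam * snd x) \<in> H_per 1 \<and>
     (AE x in Omega_measure. comp_rho \<phi> x \<ge> \<rho> - 1) \<and>
     (\<forall>j. Linf_norm (D_theta (\<lambda>x. \<phi> x $ j)) \<le> m \<and> Linf_norm (D_z (\<lambda>x. \<phi> x $ j)) \<le> m)}"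

definition min_energy :: "real \<Rightarrow> real \<Rightarrow> real \<Rightarrow> ereal \<Rightarrow> ennreal" where
  "min_energy h lam \<rho> m = (INF \<phi>\<in>admissible lam \<rho> m. energy h \<phi>)"

end

theory Submission
  imports Defs "HOL-Probability.Probability_Measure" "HOL-Real_Asymp.Real_Asymp"
begin

text \<open>
  The upper bound is the energy of uniform compression: the displacement \<open>(0, 0, - lam * z)\<close> has
  no bending and a single nonzero strain component, the constant \<open>- lam\<close>, so that its energy is
  \<open>2 * pi * lam\<^sup>2\<close> (\<open>min_energy_upper\<close>).

  For the lower bound, write \<open>u \<ge> 0\<close> for the radial displacement, \<open>v\<close> and \<open>w\<close> for its first and
  second axial derivatives and \<open>E\<close> for the energy, and suppose that \<open>E\<close> is at most
  \<open>\<tau>\<^sup>2 = lam\<^sup>2 / 10 ^ 6\<close>. Two observations drive the argument.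
  In the hoop strain, the term \<open>D_theta \<phi>\<^sub>\<theta>\<close> integrates to zero and \<open>(D_theta u)\<^sup>2 / 2\<close> is
  nonnegative, hence the integral of \<open>u\<close> is controlled by the square root of \<open>E\<close>: the obstacle
  \<open>u \<ge> 0\<close> forces \<open>u\<close> to be small in \<open>L\<^sup>1\<close>.
  In the axial strain, \<open>D_z \<phi>\<^sub>z\<close> has mean \<open>- lam\<close> on almost every slice of constant \<open>\<theta>\<close>, because
  \<open>\<phi>\<^sub>z + lam * z\<close> is periodic in \<open>z\<close>; hence half the integral of \<open>v\<^sup>2\<close> over the slice equals
  \<open>lam\<close> up to the integral of the strain. The excess length must be spent on slopes of \<open>u\<close>.

  A small nonnegative function can have large slopes only at the price of curvature. Cutting a
  slice into \<open>n\<close> cells of length \<open>1 / n\<close> gives (\<open>slice_interpolation\<close>)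
  \<open>\<integral> v\<^sup>2 \<le> 2 / n\<^sup>2 * \<integral> w\<^sup>2 + 648 * n ^ 3 * (\<integral> u)\<^sup>2\<close>. The set of slices with
  \<open>\<integral> u \<le> 5 * \<tau>\<close> has measure at least \<open>2 * pi - 1\<close>, and the bending energy bounds the
  total integral of \<open>w\<^sup>2\<close> by \<open>E / h\<^sup>2\<close>. With \<open>n\<close> of the order \<open>h powr (-2/5)\<close> the
  right-hand side, integrated over these slices, is at most a small multiple of
  \<open>lam\<^sup>2 * h powr (-6/5)\<close>. The assumption on \<open>h\<close> says precisely that \<open>h powr (6/5) \<ge> lam\<close>, so this is a
  small multiple of \<open>lam\<close>, contradicting the previous paragraph (\<open>energy_lower\<close>). All the constants are
  numerical, uniformly in \<open>m\<close>.

  The rest of the text makes weak derivatives accessible to this argument. Products of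
  one-dimensional bump functions are enough tests to determine an integrable function
  (\<open>fundamental_lemma\<close>); therefore weak derivatives are unique and, on almost every slice, a
  function is a primitive of its weak axial derivative (\<open>slice_representation\<close>). Periodic
  extension of interior test functions (\<open>per_weak_deriv_imp_interior\<close>) identifies the derivatives
  that occur in the periodic Sobolev spaces with those that occur in the energy.
\<close>

section \<open>Smooth functions and bump functions of one variable\<close>

text \<open>
  Recursion on the order makes closure under products and primitives an induction.
\<close>

primrec times_diff :: "nat \<Rightarrow> (real \<Rightarrow> real) \<Rightarrow> bool" where
  "times_diff 0 f \<longleftrightarrow> True"
| "times_diff (Suc n) f \<longleftrightarrow> (\<forall>x. f differentiable at x) \<and> times_diff n (deriv f)"

definition smooth1 :: "(real \<Rightarrow> real) \<Rightarrow> bool" where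
  "smooth1 f \<longleftrightarrow> (\<forall>n. times_diff n f)"

lemma times_diff_Suc_D: "times_diff (Suc n) f \<Longrightarrow> times_diff n f"
  by (induction n arbitrary: f) auto

text \<open>
  Allows a proof to exhibit the derivative instead of computing \<^const>\<open>deriv\<close>.
\<close>

lemma times_diff_SucI:
  assumes "\<And>x. (f has_real_derivative f' x) (at x)" "times_diff n f'"
  shows "times_diff (Suc n) f"
proof -
  have "deriv f = f'" using assms(1) by (auto intro: DERIV_imp_deriv)
  then show ?thesis using assms by (auto simp: real_differentiable_def)
qed

lemma times_diff_Suc_E:
  assumes "times_diff (Suc n) f"
  shows "(f has_real_derivative deriv f x) (at x)"
  using assms DERIV_imp_deriv unfolding times_diff.simps real_differentiable_def by metis

lemma times_diff_add: "times_diff n f \<Longrightarrow> times_diff n g \<Longrightarrow> times_diff n (\<lambda>x. f x + g x)"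
proof (induction n arbitrary: f g)
  case (Suc n)
  show ?case
    by (rule times_diff_SucI[where f' = "\<lambda>x. deriv f x + deriv g x"])
      (use Suc in \<open>auto intro!: DERIV_add times_diff_Suc_E simp del: times_diff.simps(2)\<close>,
       use Suc in auto)
qed auto

lemma times_diff_mult: "times_diff n f \<Longrightarrow> times_diff n g \<Longrightarrow> times_diff n (\<lambda>x. f x * g x)"
proof (induction n arbitrary: f g)
  case (Suc n)
  show ?case
  proof (rule times_diff_SucI[where f' = "\<lambda>x. f x * deriv g x + deriv f x * g x"])
    show "((\<lambda>x. f x * g x) has_real_derivative f x * deriv g x + deriv f x * g x) (at x)" for x
      using times_diff_Suc_E[OF Suc.prems(1)] times_diff_Suc_E[OF Suc.prems(2)]
      by (auto intro!: derivative_eq_intros)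
    show "times_diff n (\<lambda>x. f x * deriv g x + deriv f x * g x)"
      using Suc times_diff_Suc_D by (intro times_diff_add Suc.IH) auto
  qed
qed auto

lemma times_diff_const: "times_diff n (\<lambda>x. c)"
proof (induction n arbitrary: c)
  case (Suc n)
  then show ?case by (intro times_diff_SucI[where f' = "\<lambda>x. 0"]) auto
qed auto

lemma times_diff_affine: "times_diff n f \<Longrightarrow> times_diff n (\<lambda>x. f (a * x + b))"
proof (induction n arbitrary: f)
  case (Suc n)
  show ?case
  proof (rule times_diff_SucI[where f' = "\<lambda>x. a * deriv f (a * x + b)"])
    show "((\<lambda>x. f (a * x + b)) has_real_derivative a * deriv f (a * x + b)) (at x)" for x
    proof -
      have "((\<lambda>x. a * x + b) has_real_derivative a) (at x)"
        by (auto intro!: derivative_eq_intros)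
      from DERIV_chain2[OF times_diff_Suc_E[OF Suc.prems] this] show ?thesis
        by (simp add: mult.commute)
    qed
    show "times_diff n (\<lambda>x. a * deriv f (a * x + b))"
      using Suc by (intro times_diff_mult times_diff_const) auto
  qed
qed auto

lemma smooth1_mult: "smooth1 f \<Longrightarrow> smooth1 g \<Longrightarrow> smooth1 (\<lambda>x. f x * g x)"
  by (simp add: smooth1_def times_diff_mult)

lemma smooth1_add: "smooth1 f \<Longrightarrow> smooth1 g \<Longrightarrow> smooth1 (\<lambda>x. f x + g x)"
  by (simp add: smooth1_def times_diff_add)

lemma smooth1_const: "smooth1 (\<lambda>x. c)"
  by (simp add: smooth1_def times_diff_const)

lemma smooth1_affine: "smooth1 f \<Longrightarrow> smooth1 (\<lambda>x. f (a * x + b))"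
  by (simp add: smooth1_def times_diff_affine)

lemma smooth1_deriv: "smooth1 f \<Longrightarrow> smooth1 (deriv f)"
  unfolding smooth1_def by (metis times_diff.simps(2))

lemma smooth1_DERIV: "smooth1 f \<Longrightarrow> (f has_real_derivative deriv f x) (at x)"
  unfolding smooth1_def using times_diff_Suc_E by blast

lemma smooth1_continuous: "smooth1 f \<Longrightarrow> continuous_on A f"
  by (meson smooth1_DERIV DERIV_isCont continuous_at_imp_continuous_on)

lemma smooth1_antideriv:
  assumes "\<And>x. (f has_real_derivative f' x) (at x)" "smooth1 f'"
  shows "smooth1 f"
proof -
  have "times_diff (Suc n) f" for n
    using assms times_diff_SucI smooth1_def by blast
  then show ?thesis unfolding smooth1_def using times_diff_Suc_D by blast
qed

text \<open>
  All derivatives of the classical flat function \<open>exp (- 1 / x)\<close>, extended by zero to the left,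
  have this form; carrying the polynomial along turns smoothness at the origin into a single
  induction.
\<close>

definition flat_exp :: "real poly \<Rightarrow> real \<Rightarrow> real" where
  "flat_exp p x = (if x > 0 then poly p (1 / x) * exp (- (1 / x)) else 0)"

lemma poly_exp_tendsto_0: "((\<lambda>y. poly p y * exp (- y)) \<longlongrightarrow> (0::real)) at_top"
proof -
  have "((\<lambda>y. \<Sum>i\<le>degree p. coeff p i * (y ^ i / exp y)) \<longlongrightarrow> (\<Sum>i\<le>degree p. coeff p i * 0)) at_top"
    by (intro tendsto_sum tendsto_mult tendsto_const tendsto_power_div_exp_0)
  then show ?thesis
    by (simp add: poly_altdef exp_minus field_simps sum_distrib_left sum_divide_distrib)
qed

text \<open>
  At the origin the difference quotient is again of the form \<open>q (1 / x) * exp (- 1 / x)\<close>, which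
  vanishes in the limit because the exponential beats every polynomial.
\<close>

lemma flat_exp_deriv:
  "(flat_exp p has_real_derivative flat_exp ([:0, 0, 1:] * (p - pderiv p)) x) (at x)"
proof -
  consider "x < 0" | "x = 0" | "x > 0" by linarith
  then show ?thesis
  proof cases
    case 1
    have "((\<lambda>x. 0) has_real_derivative 0) (at x)" by simp
    moreover have "eventually (\<lambda>y. y < 0) (nhds x)"
      using 1 by (intro eventually_nhds_in_open[of "{..<0}", simplified]) auto
    then have "eventually (\<lambda>y. 0 = flat_exp p y) (nhds x)"
      by eventually_elim (auto simp: flat_exp_def)
    ultimately have "(flat_exp p has_real_derivative 0) (at x)"
      by (subst DERIV_cong_ev[OF refl, of _ "\<lambda>x. 0" _ 0]) (auto elim: eventually_mono)
    then show ?thesis using 1 by (simp add: flat_exp_def)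
  next
    case 3
    have "((\<lambda>x. poly p (1 / x) * exp (- (1 / x))) has_real_derivative
        poly ([:0, 0, 1:] * (p - pderiv p)) (1 / x) * exp (- (1 / x))) (at x)"
      using 3
      by (auto intro!: derivative_eq_intros poly_DERIV[THEN DERIV_chain2] simp: field_simps power2_eq_square)
    moreover have "eventually (\<lambda>y. y > 0) (nhds x)"
      using 3 by (intro eventually_nhds_in_open[of "{0<..}", simplified]) auto
    then have "eventually (\<lambda>y. flat_exp p y = poly p (1 / y) * exp (- (1 / y))) (nhds x)"
      by eventually_elim (auto simp: flat_exp_def)
    ultimately have "(flat_exp p has_real_derivative poly ([:0, 0, 1:] * (p - pderiv p)) (1 / x) * exp (- (1 / x))) (at x)"
      by (subst DERIV_cong_ev[OF refl _ refl]) auto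
    then show ?thesis using 3 by (simp add: flat_exp_def)
  next
    case 2
    have "((\<lambda>x. poly ([:0,1:] * p) (inverse x) * exp (- inverse x)) \<longlongrightarrow> 0) (at_right (0::real))"
      using filterlim_compose[OF poly_exp_tendsto_0 filterlim_inverse_at_top_right] .
    then have R: "((\<lambda>x. flat_exp p x / x) \<longlongrightarrow> 0) (at_right (0::real))"
      by (rule tendsto_cong[THEN iffD1, rotated])
        (auto simp: flat_exp_def eventually_at_filter field_simps)
    have "((\<lambda>x. 0) \<longlongrightarrow> 0) (at_left (0::real))" by simp
    then have L: "((\<lambda>x. flat_exp p x / x) \<longlongrightarrow> 0) (at_left (0::real))"
      by (rule tendsto_cong[THEN iffD1, rotated])
        (auto simp: flat_exp_def eventually_at_filter)
    have "((\<lambda>x. flat_exp p x / x) \<longlongrightarrow> 0) (at (0::real))"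
      using L R by (simp add: filterlim_split_at)
    then show ?thesis using 2 by (simp add: DERIV_def flat_exp_def)
  qed
qed

lemma smooth1_flat_exp: "smooth1 (flat_exp p)"
proof -
  have "times_diff n (flat_exp p)" for n
    by (induction n arbitrary: p) (auto simp del: times_diff.simps(2) intro: times_diff_SucI flat_exp_deriv)
  then show ?thesis by (simp add: smooth1_def)
qed

text \<open>
  A smooth substitute for the indicator of the open interval from \<open>s\<close> to \<open>t\<close>. The shift by
  \<open>1\<close> keeps the support at distance \<open>1 / n\<close> from the end points, so that \<open>s\<close> and \<open>t\<close> may lie on
  the boundary of the domain.
\<close>

definition plateau :: "real \<Rightarrow> real \<Rightarrow> nat \<Rightarrow> real \<Rightarrow> real" where
  "plateau s t n x = flat_exp 1 (real n * (x - s) - 1) * flat_exp 1 (real n * (t - x) - 1)"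

text \<open>
  The margin \<open>\<delta>\<close> expresses that the support is a compact subset of the open interval.
\<close>

definition tests1 :: "real \<Rightarrow> real \<Rightarrow> (real \<Rightarrow> real) set" where
  "tests1 s t = {f. smooth1 f \<and> (\<exists>\<delta>>0. \<forall>x. x \<notin> {s + \<delta>..t - \<delta>} \<longrightarrow> f x = 0)}"

lemma flat_exp_1_bounds: "0 \<le> flat_exp 1 x" "flat_exp 1 x \<le> 1" 
  by (auto simp: flat_exp_def)

lemma plateau_bounds: "0 \<le> plateau s t n x" "plateau s t n x \<le> 1"
  using flat_exp_1_bounds by (auto simp: plateau_def mult_le_one)

lemma smooth1_plateau: "smooth1 (plateau s t n)"
proof -
  have "smooth1 (\<lambda>x. flat_exp 1 (real n * x + (- real n * s - 1)) * flat_exp 1 (- real n * x + (real n * t - 1)))"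
    by (intro smooth1_mult smooth1_affine smooth1_flat_exp)
  then show ?thesis by (simp add: plateau_def[abs_def] algebra_simps)
qed

lemma plateau_tests1:
  assumes "n > 0" "s0 \<le> s" "t \<le> t0"
  shows "plateau s t n \<in> tests1 s0 t0"
proof -
  have "plateau s t n x = 0" if "x \<notin> {s0 + 1 / real n..t0 - 1 / real n}" for x
  proof -
    from that have "x \<le> s + 1 / n \<or> x \<ge> t - 1 / n" using assms by auto
    then have "real n * (x - s) - 1 \<le> 0 \<or> real n * (t - x) - 1 \<le> 0"
      using assms by (auto simp: field_simps)
    then show ?thesis by (auto simp: plateau_def flat_exp_def)
  qed
  then show ?thesis unfolding tests1_def using assms smooth1_plateau by (auto intro!: exI[of _ "1 / real n"])
qed

lemma plateau_tendsto: "(\<lambda>n. plateau s t n x) \<longlonglongrightarrow> indicator {s<..<t} x"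
proof -
  have A: "(\<lambda>n. flat_exp 1 (real n * y - 1)) \<longlonglongrightarrow> (if y > 0 then 1 else 0)" for y :: real
  proof (cases "y > 0")
    case True
    have "eventually (\<lambda>n. real n * y - 1 > 0) sequentially"
      using True by real_asymp
    then have ev: "eventually (\<lambda>n. exp (- (1 / (real n * y - 1))) = flat_exp 1 (real n * y - 1)) sequentially"
      by eventually_elim (auto simp: flat_exp_def)
    have "(\<lambda>n. exp (- (1 / (real n * y - 1)))) \<longlonglongrightarrow> 1"
      using True by real_asymp
    then show ?thesis using True tendsto_cong[OF ev] by auto
  next
    case False
    then have "real n * y \<le> 0" for n
      by (simp add: mult_nonneg_nonpos)
    then have "\<not> real n * y - 1 > 0" for n
      by (smt (verit))
    then show ?thesis using False by (simp add: flat_exp_def)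
  qed
  have "(\<lambda>n. plateau s t n x) \<longlonglongrightarrow> (if x - s > 0 then 1 else 0) * (if t - x > 0 then 1 else 0)"
    unfolding plateau_def by (intro tendsto_mult A)
  then show ?thesis by (auto simp: indicator_def split: if_splits)
qed

lemma tests1_deriv:
  assumes "f \<in> tests1 s t" shows "deriv f \<in> tests1 s t"
proof -
  obtain \<delta> where d: "\<delta> > 0" "\<And>x. x \<notin> {s + \<delta>..t - \<delta>} \<Longrightarrow> f x = 0" and sm: "smooth1 f"
    using assms by (auto simp: tests1_def)
  have "deriv f x = 0" if "x \<notin> {s + \<delta>..t - \<delta>}" for x
  proof -
    have "open (- {s + \<delta>..t - \<delta>})" by (simp add: open_Compl)
    then have "eventually (\<lambda>y. y \<in> - {s + \<delta>..t - \<delta>}) (nhds x)"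
      using that by (intro eventually_nhds_in_open) auto
    then have "eventually (\<lambda>y. f y = 0) (nhds x)" by eventually_elim (use d in auto)
    then have "deriv f x = deriv (\<lambda>x. 0) x" by (rule deriv_cong_ev) simp
    then show ?thesis by simp
  qed
  then show ?thesis using sm d unfolding tests1_def by (auto intro: smooth1_deriv)
qed

lemma tests1_smooth1: "f \<in> tests1 s t \<Longrightarrow> smooth1 f"
  by (simp add: tests1_def)

lemma tests1_zero: "f \<in> tests1 s t \<Longrightarrow> x \<notin> {s<..<t} \<Longrightarrow> f x = 0"
  by (force simp: tests1_def)

text \<open>
  The primitive is constant on either side of the support; both constants agree because the total
  integral vanishes, so subtracting the common value gives compact support.
\<close>

lemma tests1_antideriv:
  assumes b: "b \<in> tests1 s t" and int0: "integral {s..t} b = 0" and st: "s \<le> t"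
  shows "\<exists>B\<in>tests1 s t. deriv B = b"
proof -
  have "\<exists>F. \<forall>x :: real. - \<infinity> < ereal x \<longrightarrow> ereal x < \<infinity> \<longrightarrow> (F has_vector_derivative b x) (at x)"
    using smooth1_DERIV[OF tests1_smooth1[OF b]] by (intro einterval_antiderivative) (auto intro: DERIV_isCont)
  then obtain F where F: "\<And>x. (F has_real_derivative b x) (at x)"
    by (auto simp: has_real_derivative_iff_has_vector_derivative)
  obtain \<delta> where d: "\<delta> > 0" "\<And>x. x \<notin> {s + \<delta>..t - \<delta>} \<Longrightarrow> b x = 0"
    using b by (auto simp: tests1_def)
  have ib: "(b has_integral F t - F s) {s..t}"
    using F st by (intro fundamental_theorem_of_calculus)
      (auto simp: has_real_derivative_iff_has_vector_derivative intro: has_vector_derivative_at_within)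
  then have Fst: "F t = F s" using int0 integral_unique[OF ib] by simp
  have left: "F x = F s" if "x < s + \<delta>" for x
  proof -
    have "\<exists>c. \<forall>x\<in>{..<s+\<delta>}. F x = c"
    proof (rule has_field_derivative_zero_constant)
      show "(F has_real_derivative 0) (at x within {..<s+\<delta>})" if "x \<in> {..<s+\<delta>}" for x
        using F[of x] d(2)[of x] that by (auto intro: has_field_derivative_at_within)
    qed simp
    then show ?thesis using that d by auto
  qed
  have right: "F x = F t" if "x > t - \<delta>" for x
  proof -
    have "\<exists>c. \<forall>x\<in>{t-\<delta><..}. F x = c"
    proof (rule has_field_derivative_zero_constant)
      show "(F has_real_derivative 0) (at x within {t-\<delta><..})" if "x \<in> {t-\<delta><..}" for x
        using F[of x] d(2)[of x] that by (auto intro: has_field_derivative_at_within)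
    qed simp
    then show ?thesis using that d by auto
  qed
  define B where "B x = F x - F s" for x
  have DB: "(B has_real_derivative b x) (at x)" for x
    unfolding B_def[abs_def] using F by (auto intro!: derivative_eq_intros)
  have "deriv B = b" using DB by (auto intro: DERIV_imp_deriv)
  moreover have "smooth1 B" using DB tests1_smooth1[OF b] smooth1_antideriv by blast
  moreover have "B x = 0" if "x \<notin> {s + \<delta>..t - \<delta>}" for x
    using that left[of x] right[of x] Fst by (auto simp: B_def)
  ultimately show ?thesis using d by (auto simp: tests1_def)
qed

section \<open>Tensor products as test functions\<close>

definition tensor :: "(real \<Rightarrow> real) \<Rightarrow> (real \<Rightarrow> real) \<Rightarrow> real \<times> real \<Rightarrow> real" where
  "tensor a b = (\<lambda>(x, y). a x * b y)"

lemma pd_theta_tensor: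
  assumes "smooth1 a" shows "pd_theta (tensor a b) = tensor (deriv a) b"
proof -
  have "deriv (\<lambda>t. a t * b y) x = deriv a x * b y" for x y
    by (rule DERIV_imp_deriv[OF DERIV_cmult_right[OF smooth1_DERIV[OF assms]]])
  then show ?thesis by (simp add: pd_theta_def tensor_def fun_eq_iff)
qed

lemma pd_z_tensor:
  assumes "smooth1 b" shows "pd_z (tensor a b) = tensor a (deriv b)"
proof -
  have "deriv (\<lambda>t. a x * b t) y = a x * deriv b y" for x y
    by (rule DERIV_imp_deriv[OF DERIV_cmult[OF smooth1_DERIV[OF assms]]])
  then show ?thesis by (simp add: pd_z_def tensor_def fun_eq_iff)
qed

lemma smooth1_deriv_pow: "smooth1 a \<Longrightarrow> smooth1 ((deriv ^^ n) a)"
  by (induction n) (auto intro: smooth1_deriv)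

lemma pd_tensor:
  assumes "smooth1 a" "smooth1 b"
  shows "pd i j (tensor a b) = tensor ((deriv ^^ i) a) ((deriv ^^ j) b)"
proof -
  have "(pd_z ^^ j) (tensor a b) = tensor a ((deriv ^^ j) b)"
    by (induction j) (auto simp: pd_z_tensor smooth1_deriv_pow assms)
  moreover have "(pd_theta ^^ i) (tensor a c) = tensor ((deriv ^^ i) a) c" for c
    by (induction i) (auto simp: pd_theta_tensor smooth1_deriv_pow assms)
  ultimately show ?thesis by (simp add: pd_def)
qed

lemma smooth1_differentiable: "smooth1 a \<Longrightarrow> a differentiable at x"
  using smooth1_DERIV real_differentiable_def by blast

lemma tensor_differentiable:
  assumes "smooth1 a" "smooth1 b" shows "tensor a b differentiable at x"
proof -
  have "(\<lambda>x. a (fst x)) differentiable at x"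
    using differentiable_chain_at[of fst x a] smooth1_differentiable[OF assms(1)]
    by (simp add: o_def bounded_linear_imp_differentiable bounded_linear_fst)
  moreover have "(\<lambda>x. b (snd x)) differentiable at x"
    using differentiable_chain_at[of snd x b] smooth1_differentiable[OF assms(2)]
    by (simp add: o_def bounded_linear_imp_differentiable bounded_linear_snd)
  ultimately show ?thesis by (simp add: tensor_def case_prod_beta')
qed

lemma smooth_tensor: "smooth1 a \<Longrightarrow> smooth1 b \<Longrightarrow> smooth (tensor a b)"
  unfolding smooth_def differentiable_on_def
  by (simp add: pd_tensor tensor_differentiable smooth1_deriv_pow)

lemma interior_Omega: "interior Omega = {0<..<2 * pi} \<times> {-(1/2)<..<1/2}"
  by (simp add: Omega_def interior_Times)

lemma tensor_interior_tests:
  assumes "a \<in> tests1 0 (2 * pi)" "b \<in> tests1 (-(1/2)) (1/2)"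
  shows "tensor a b \<in> interior_tests"
proof -
  obtain \<delta> where d: "\<delta> > 0" "\<And>x. x \<notin> {0 + \<delta>..2 * pi - \<delta>} \<Longrightarrow> a x = 0"
    using assms by (auto simp: tests1_def)
  obtain \<epsilon> where e: "\<epsilon> > 0" "\<And>x. x \<notin> {-(1/2) + \<epsilon>..1/2 - \<epsilon>} \<Longrightarrow> b x = 0"
    using assms unfolding tests1_def by blast
  have "closure {x. tensor a b x \<noteq> 0} \<subseteq> {0 + \<delta>..2 * pi - \<delta>} \<times> {-(1/2) + \<epsilon>..1/2 - \<epsilon>}"
  proof (rule closure_minimal)
    show "{x. tensor a b x \<noteq> 0} \<subseteq> {0 + \<delta>..2 * pi - \<delta>} \<times> {-(1/2) + \<epsilon>..1/2 - \<epsilon>}"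
      using d(2) e(2) by (force simp: tensor_def)
  qed (simp add: closed_Times)
  also have "\<dots> \<subseteq> interior Omega"
    unfolding interior_Omega using d e by auto
  finally show ?thesis
    using smooth_tensor assms by (auto simp: interior_tests_def tests1_smooth1)
qed

lemma continuous_on_tensor: "smooth1 a \<Longrightarrow> smooth1 b \<Longrightarrow> continuous_on A (tensor a b)"
  by (intro continuous_at_imp_continuous_on ballI differentiable_imp_continuous_within tensor_differentiable)

section \<open>The domain as a product measure space\<close>

abbreviation M_theta :: "real measure" where "M_theta \<equiv> restrict_space lborel {0..2 * pi}"
abbreviation M_z :: "real measure" where "M_z \<equiv> restrict_space lborel {-(1/2)..1/2}"

lemma finite_M_theta: "finite_measure M_theta"
  by (rule finite_measureI) (simp add: emeasure_restrict_space)

lemma finite_M_z: "finite_measure M_z"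
  by (rule finite_measureI) (simp add: emeasure_restrict_space)

lemma Omega_borel [measurable]: "Omega \<in> sets borel"
  by (simp add: Omega_def borel_closed closed_Times)

text \<open>
  Restricting to a rectangle commutes with forming the product sigma-algebra; both inclusions are
  measurability of the identity map.
\<close>

lemma sets_pair_restrict_space:
  "sets (restrict_space M A \<Otimes>\<^sub>M restrict_space N B) = sets (restrict_space (M \<Otimes>\<^sub>M N) (A \<times> B))"
  (is "sets ?P = sets ?R")
proof
  have "(\<lambda>x. x) \<in> ?R \<rightarrow>\<^sub>M ?P"
    by (rule measurable_pair)
      (auto intro!: measurable_restrict_space3 simp: o_def)
  then show "sets ?P \<subseteq> sets ?R"
  proof (intro subsetI)
    fix X assume m: "(\<lambda>x. x) \<in> ?R \<rightarrow>\<^sub>M ?P" and X: "X \<in> sets ?P"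
    have "X \<subseteq> space ?R"
      using sets.sets_into_space[OF X] by (auto simp: space_pair_measure space_restrict_space)
    then show "X \<in> sets ?R" using measurable_sets[OF m X] by (simp add: Int_absorb2)
  qed
  have id: "(\<lambda>x. x) \<in> restrict_space L C \<rightarrow>\<^sub>M L" for L :: "'x measure" and C
    by (rule measurable_restrict_space1) simp
  have "(\<lambda>x. (fst x, snd x)) \<in> ?P \<rightarrow>\<^sub>M M \<Otimes>\<^sub>M N"
    by (rule measurable_Pair[OF measurable_compose[OF measurable_fst id] measurable_compose[OF measurable_snd id]])
  then have "(\<lambda>x. x) \<in> ?P \<rightarrow>\<^sub>M M \<Otimes>\<^sub>M N" by simp
  moreover have "(\<lambda>x. x) \<in> space ?P \<rightarrow> A \<times> B"
    by (auto simp: space_pair_measure space_restrict_space)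
  ultimately have m: "(\<lambda>x. x) \<in> ?P \<rightarrow>\<^sub>M ?R"
    by (intro measurable_restrict_space2) auto
  show "sets ?R \<subseteq> sets ?P"
  proof (intro subsetI)
    fix X assume X: "X \<in> sets ?R"
    have "X \<subseteq> space ?P"
      using sets.sets_into_space[OF X] by (auto simp: space_pair_measure space_restrict_space)
    then show "X \<in> sets ?P" using measurable_sets[OF m X] by (simp add: Int_absorb2)
  qed
qed

text \<open>
  This makes Fubini's theorem available for integrals over the rectangle.
\<close>

lemma Omega_measure_eq: "Omega_measure = M_theta \<Otimes>\<^sub>M M_z"
proof (rule pair_measure_eqI[symmetric])
  show "sigma_finite_measure M_theta" "sigma_finite_measure M_z"
    using finite_M_theta finite_M_z finite_measure_def by auto
  have "sets Omega_measure = sets (restrict_space (lborel \<Otimes>\<^sub>M lborel) Omega)"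
    by (simp only: lborel_prod)
  also have "\<dots> = sets (M_theta \<Otimes>\<^sub>M M_z)"
    unfolding Omega_def by (rule sets_pair_restrict_space[symmetric])
  finally show "sets (M_theta \<Otimes>\<^sub>M M_z) = sets Omega_measure" ..
  show "emeasure M_theta A * emeasure M_z B = emeasure Omega_measure (A \<times> B)"
    if "A \<in> sets M_theta" "B \<in> sets M_z" for A B
  proof -
    have AB: "A \<in> sets lborel" "A \<subseteq> {0..2*pi}" "B \<in> sets lborel" "B \<subseteq> {-(1/2)..1/2}"
      using that by (auto simp: sets_restrict_space)
    then have "emeasure M_theta A * emeasure M_z B = emeasure lborel A * emeasure lborel B"
      by (simp add: emeasure_restrict_space)
    also have "\<dots> = emeasure (lborel \<Otimes>\<^sub>M lborel) (A \<times> B)"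
      using AB by (simp add: lborel.emeasure_pair_measure_Times)
    also have "\<dots> = emeasure Omega_measure (A \<times> B)"
      using AB by (subst emeasure_restrict_space) (use Omega_borel in \<open>auto simp: lborel_prod Omega_def\<close>)
    finally show ?thesis .
  qed
qed

lemma space_Omega_measure: "space Omega_measure = Omega"
  by (simp add: space_restrict_space)

lemma emeasure_Omega: "emeasure Omega_measure Omega = ennreal (2 * pi)"
proof -
  have "emeasure Omega_measure Omega = emeasure (lborel \<Otimes>\<^sub>M lborel) ({0..2 * pi} \<times> {-(1/2)..1/2::real})"
    by (subst emeasure_restrict_space) (auto simp: lborel_prod Omega_def[symmetric])
  also have "\<dots> = ennreal (2 * pi)"
    by (subst lborel.emeasure_pair_measure_Times) auto
  finally show ?thesis .
qed

lemma finite_Omega_measure: "finite_measure Omega_measure"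
  by (rule finite_measureI) (simp add: space_Omega_measure emeasure_Omega)

lemma AE_interior_Omega: "AE x in Omega_measure. x \<in> interior Omega"
proof -
  have "convex Omega" unfolding Omega_def by (intro convex_Times) auto
  then have "frontier Omega \<in> null_sets lborel"
    using negligible_convex_frontier[of Omega] by (simp add: negligible_iff_null_sets null_sets_completion_iff)
  then have "AE x in lborel. x \<notin> frontier Omega" by (rule AE_not_in)
  then have "AE x in lborel. x \<in> Omega \<longrightarrow> x \<in> interior Omega"
    by eventually_elim (use closure_subset in \<open>auto simp: frontier_def\<close>)
  then show ?thesis by (subst AE_restrict_space_iff) auto
qed

lemma box_pair: "box (a, c) (b, d) = {a<..<b} \<times> {c<..<(d::real)}" for a b :: real
  by (auto simp: mem_box Basis_prod_def)

section \<open>Uniqueness of weak derivatives\<close>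

text \<open>
  Testing with products of \<open>plateau\<close> functions and passing to the limit by dominated convergence
  shows that the integral of \<open>r\<close> over every box vanishes. Boxes form an intersection-stable generator of
  the Borel sets, so the integral over every Borel set vanishes.
\<close>

lemma fundamental_lemma:
  assumes r: "integrable Omega_measure r"
    and test: "\<And>a b. a \<in> tests1 0 (2 * pi) \<Longrightarrow> b \<in> tests1 (-(1/2)) (1/2) \<Longrightarrow>
      (LINT x|Omega_measure. r x * tensor a b x) = 0"
  shows "AE x in Omega_measure. r x = (0::real)"
proof -
  define r' where "r' x = indicat_real Omega x * r x" for x
  have r': "integrable lborel r'"
    using r unfolding r'_def[abs_def] by (subst (asm) integrable_restrict_space) auto
  have LR: "(LINT x|Omega_measure. r x * g x) = (LINT x|lborel. r' x * g x)" for g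
    unfolding r'_def by (subst integral_restrict_space) (auto simp: mult.assoc)
  have rm[measurable]: "r' \<in> borel_measurable borel" using r' by auto
  have rect: "(LINT x|lborel. r' x * indicator ({s<..<t} \<times> {s'<..<t'}) x) = 0"
    if "0 \<le> s" "t \<le> 2 * pi" "-(1/2) \<le> s'" "t' \<le> 1/2" for s t s' t'
  proof -
    let ?T = "\<lambda>n. tensor (plateau s t (Suc n)) (plateau s' t' (Suc n))"
    have "(\<lambda>n. LINT x|lborel. r' x * ?T n x) \<longlonglongrightarrow> (LINT x|lborel. r' x * indicator ({s<..<t} \<times> {s'<..<t'}) x)"
    proof (rule integral_dominated_convergence[where w = "\<lambda>x. norm (r' x)"])
      show "(\<lambda>x. r' x * ?T n x) \<in> borel_measurable lborel" for n
        using borel_measurable_continuous_onI[OF continuous_on_tensor[OF smooth1_plateau smooth1_plateau]]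
        by (intro borel_measurable_times) simp_all
      have [measurable]: "{s<..<t} \<times> {s'<..<t'} \<in> sets borel"
        by (intro borel_open open_Times) auto
      show "(\<lambda>x. r' x * indicator ({s<..<t} \<times> {s'<..<t'}) x) \<in> borel_measurable lborel"
        by simp
      show "integrable lborel (\<lambda>x. norm (r' x))" using r' by simp
      show "AE x in lborel. (\<lambda>n. r' x * ?T n x) \<longlonglongrightarrow> r' x * indicator ({s<..<t} \<times> {s'<..<t'}) x"
      proof (rule AE_I2)
        fix x :: "real \<times> real"
        have "(\<lambda>n. r' x * (plateau s t (Suc n) (fst x) * plateau s' t' (Suc n) (snd x)))
          \<longlonglongrightarrow> r' x * (indicator {s<..<t} (fst x) * indicator {s'<..<t'} (snd x))"
          by (intro tendsto_intros LIMSEQ_Suc plateau_tendsto)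
        then show "(\<lambda>n. r' x * ?T n x) \<longlonglongrightarrow> r' x * indicator ({s<..<t} \<times> {s'<..<t'}) x"
          by (cases x) (simp add: tensor_def indicator_times)
      qed
      show "AE x in lborel. norm (r' x * ?T n x) \<le> norm (r' x)" for n
      proof (rule AE_I2)
        fix x :: "real \<times> real"
        have "\<bar>?T n x\<bar> \<le> 1"
          using plateau_bounds by (auto simp: tensor_def case_prod_beta' abs_mult intro!: mult_le_one)
        then show "norm (r' x * ?T n x) \<le> norm (r' x)"
          by (simp add: abs_mult mult_left_le)
      qed
    qed
    moreover have "(LINT x|lborel. r' x * ?T n x) = 0" for n
      using test[OF plateau_tests1 plateau_tests1, of "Suc n" s t "Suc n" s' t'] that LR by simp
    ultimately show ?thesis by (simp add: LIMSEQ_const_iff)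
  qed
  have AEi: "AE x in lborel. r' x \<noteq> 0 \<longrightarrow> x \<in> interior Omega"
    using AE_interior_Omega unfolding r'_def
    by (subst (asm) AE_restrict_space_iff) (auto simp: indicator_def)
  have box: "(LINT x:box p q|lborel. r' x) = 0" for p q
  proof -
    obtain s s' t t' where pq: "p = (s, s')" "q = (t, t')" by (metis surj_pair)
    have "(LINT x:box p q|lborel. r' x)
      = (LINT x|lborel. r' x * indicator ({max 0 s<..<min (2*pi) t} \<times> {max (-(1/2)) s'<..<min (1/2) t'}) x)"
      unfolding set_lebesgue_integral_def
    proof (rule integral_cong_AE)
      show "AE x in lborel. indicator (box p q) x *\<^sub>R r' x = r' x * indicator ({max 0 s<..<min (2*pi) t} \<times> {max (-(1/2)) s'<..<min (1/2) t'}) x"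
        using AEi by eventually_elim (auto simp: pq box_pair interior_Omega indicator_def)
      have [measurable]: "{max 0 s<..<min (2*pi) t} \<times> {max (-(1/2)) s'<..<min (1/2) t'} \<in> sets borel"
        by (intro borel_open open_Times) auto
      show "(\<lambda>x. r' x * indicator ({max 0 s<..<min (2*pi) t} \<times> {max (-(1/2)) s'<..<min (1/2) t'}) x) \<in> borel_measurable lborel"
        by simp
    qed simp
    also have "\<dots> = 0" by (rule rect) auto
    finally show ?thesis .
  qed
  have tot: "(LINT x|lborel. r' x) = 0"
  proof -
    have "(LINT x|lborel. r' x) = (LINT x:box (0, -(1/2)) (2*pi, 1/2)|lborel. r' x)"
      unfolding set_lebesgue_integral_def
      by (rule integral_cong_AE, simp, simp, use AEi in eventually_elim)
        (auto simp: box_pair interior_Omega indicator_def)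
    then show ?thesis using box by simp
  qed
  have all: "(LINT x:A|lborel. r' x) = 0" if "A \<in> sets borel" for A
  proof -
    have "Int_stable (range (\<lambda>(a, b). box a b :: (real \<times> real) set))"
      by (auto simp: Int_stable_def box_Int_box)
    moreover have "(range (\<lambda>(a, b). box a b :: (real \<times> real) set)) \<subseteq> Pow UNIV"
      by auto
    moreover have "A \<in> sigma_sets UNIV (range (\<lambda>(a, b). box a b))"
       using that unfolding borel_eq_box by simp
    ultimately show ?thesis
    proof (induction rule: sigma_sets_induct_disjoint)
      case (basic A) then show ?case using box by auto
    next
      case empty then show ?case by (simp add: set_lebesgue_integral_def)
    next
      case (compl A)
      then have [measurable]: "A \<in> sets borel" by (simp add: borel_eq_box)
      have si: "set_integrable lborel A r'"
        using integrable_mult_indicator[OF _ r', of A] by (simp add: set_integrable_def)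
      have "(LINT x:UNIV - A|lborel. r' x) = (LINT x|lborel. r' x - indicator A x *\<^sub>R r' x)"
        unfolding set_lebesgue_integral_def by (rule Bochner_Integration.integral_cong) (auto simp: indicator_def)
      also have "\<dots> = 0"
        using compl tot r' si
        by (subst Bochner_Integration.integral_diff) (auto simp: set_lebesgue_integral_def set_integrable_def)
      finally show ?case .
    next
      case (union F)
      then have [measurable]: "F i \<in> sets borel" for i
        by (simp add: borel_eq_box subset_eq)
      have "(LINT x:(\<Union>i. F i)|lborel. r' x) = (\<Sum>i. (LINT x:F i|lborel. r' x))"
        by (rule lebesgue_integral_countable_add)
          (use union(1) integrable_mult_indicator[OF _ r', of "\<Union>i. F i"] in \<open>auto simp: disjoint_family_on_def set_integrable_def\<close>)
      then show ?case using union by simp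
    qed
  qed
  have "AE x in lborel. r' x = 0"
    by (rule density_unique_real[OF r']) (use all in \<open>auto simp: set_lebesgue_integral_def\<close>)
  then show ?thesis
    by (subst AE_restrict_space_iff) (auto simp: r'_def)
qed

lemma L2_mult_integrable:
  assumes "f \<in> L2" "g \<in> L2" shows "integrable Omega_measure (\<lambda>x. f x * g x)"
proof (rule Bochner_Integration.integrable_bound)
  show "integrable Omega_measure (\<lambda>x. (f x)\<^sup>2 + (g x)\<^sup>2)"
    using assms by (intro Bochner_Integration.integrable_add) (auto simp: L2_def)
  show "(\<lambda>x. f x * g x) \<in> borel_measurable Omega_measure"
    using assms by (intro borel_measurable_times) (auto simp: L2_def)
  have "\<bar>a * b\<bar> \<le> a\<^sup>2 + b\<^sup>2" for a b :: real
  proof -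
    have "2 * (\<bar>a\<bar> * \<bar>b\<bar>) \<le> \<bar>a\<bar>\<^sup>2 + \<bar>b\<bar>\<^sup>2"
      using sum_squares_bound[of "\<bar>a\<bar>" "\<bar>b\<bar>"] by (simp add: mult.assoc)
    moreover have "0 \<le> \<bar>a\<bar> * \<bar>b\<bar>" by simp
    ultimately have "\<bar>a\<bar> * \<bar>b\<bar> \<le> \<bar>a\<bar>\<^sup>2 + \<bar>b\<bar>\<^sup>2" by linarith
    then show ?thesis by (simp add: abs_mult)
  qed
  then show "AE x in Omega_measure. norm (f x * g x) \<le> norm ((f x)\<^sup>2 + (g x)\<^sup>2)" by simp
qed

lemma continuous_L2:
  assumes "continuous_on UNIV f" shows "f \<in> L2"
proof -
  interpret finite_measure Omega_measure by (rule finite_Omega_measure)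
  have [measurable]: "f \<in> borel_measurable Omega_measure"
    using borel_measurable_continuous_onI[OF assms] by (intro measurable_restrict_space1) simp
  have "compact Omega" unfolding Omega_def by (intro compact_Times) auto
  then have "bounded (f ` Omega)"
    using compact_continuous_image[of Omega f] assms continuous_on_subset compact_imp_bounded by blast
  then obtain K where K: "\<And>x. x \<in> Omega \<Longrightarrow> norm (f x) \<le> K" unfolding bounded_iff by auto
  have "integrable Omega_measure (\<lambda>x. (f x)\<^sup>2)"
  proof (rule integrable_const_bound[where B = "K\<^sup>2"])
    show "AE x in Omega_measure. norm ((f x)\<^sup>2) \<le> K\<^sup>2"
    proof (rule AE_I2)
      fix x assume "x \<in> space Omega_measure"
      then have "\<bar>f x\<bar> \<le> \<bar>K\<bar>" using K[of x] by (simp add: space_Omega_measure)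
      then show "norm ((f x)\<^sup>2) \<le> K\<^sup>2" by (simp add: abs_le_square_iff)
    qed
  qed simp
  then show ?thesis by (simp add: L2_def)
qed

lemma const_L2: "(\<lambda>x. c) \<in> L2"
  by (intro continuous_L2 continuous_on_const)

lemma L2_integrable: "f \<in> L2 \<Longrightarrow> integrable Omega_measure f"
  using L2_mult_integrable[OF _ const_L2[of 1]] by simp

lemma L2_add: "f \<in> L2 \<Longrightarrow> g \<in> L2 \<Longrightarrow> (\<lambda>x. f x + g x) \<in> L2"
  using L2_mult_integrable[of f g]
  by (auto simp: L2_def power2_sum mult.assoc intro!: borel_measurable_add Bochner_Integration.integrable_add)

lemma smooth_pd_L2: "smooth \<psi> \<Longrightarrow> pd i j \<psi> \<in> L2"
  unfolding smooth_def by (intro continuous_L2 differentiable_imp_continuous_on) auto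

lemma smooth_L2: "smooth \<psi> \<Longrightarrow> \<psi> \<in> L2"
  using smooth_pd_L2[of \<psi> 0 0] by (simp add: pd_def)

lemma weak_deriv_AE_unique:
  assumes fg: "f \<in> L2" "g \<in> L2"
    and wd: "has_weak_deriv interior_tests i j u f" "has_weak_deriv interior_tests i j u g"
  shows "AE x in Omega_measure. f x = g x"
proof -
  have "AE x in Omega_measure. f x - g x = 0"
  proof (rule fundamental_lemma)
    show "integrable Omega_measure (\<lambda>x. f x - g x)"
      using fg by (intro Bochner_Integration.integrable_diff L2_integrable)
    fix a b assume "a \<in> tests1 0 (2 * pi)" "b \<in> tests1 (-(1/2)) (1/2)"
    then have T: "tensor a b \<in> interior_tests" by (rule tensor_interior_tests)
    then have L: "tensor a b \<in> L2" by (simp add: interior_tests_def smooth_L2)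
    have "(-1) ^ (i + j) * (LINT x|Omega_measure. f x * tensor a b x)
        = (-1) ^ (i + j) * (LINT x|Omega_measure. g x * tensor a b x)"
      using wd T unfolding has_weak_deriv_def by metis
    then have "(LINT x|Omega_measure. f x * tensor a b x) = (LINT x|Omega_measure. g x * tensor a b x)"
      by simp
    then show "(LINT x|Omega_measure. (f x - g x) * tensor a b x) = 0"
      using L2_mult_integrable[OF fg(1) L] L2_mult_integrable[OF fg(2) L]
      by (simp add: left_diff_distrib)
  qed
  then show ?thesis by eventually_elim simp
qed

text \<open>
  Uniqueness lets any weak derivative at hand replace the arbitrary choice made by
  \<^const>\<open>weak_deriv\<close>.
\<close>

lemma weak_deriv_AE:
  assumes "g \<in> L2" "has_weak_deriv interior_tests i j u g"
  shows "weak_deriv i j u \<in> L2" "AE x in Omega_measure. weak_deriv i j u x = g x"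
    "has_weak_deriv interior_tests i j u (weak_deriv i j u)"
proof -
  have *: "weak_deriv i j u \<in> L2 \<and> has_weak_deriv interior_tests i j u (weak_deriv i j u)"
    unfolding weak_deriv_def by (rule someI[of _ g]) (use assms in auto)
  then show "weak_deriv i j u \<in> L2" "has_weak_deriv interior_tests i j u (weak_deriv i j u)" by auto
  show "AE x in Omega_measure. weak_deriv i j u x = g x"
    using weak_deriv_AE_unique * assms by blast
qed

section \<open>From periodic to interior weak derivatives\<close>

lemma deriv_shift: "deriv (\<lambda>t. g (t + s)) x = deriv g (x + s :: real)"
proof -
  have "(\<lambda>D. (g has_field_derivative D) (at (x + s))) = (\<lambda>D. ((\<lambda>t. g (t + s)) has_field_derivative D) (at x))"
    by (rule ext) (rule DERIV_shift)
  then show ?thesis unfolding deriv_def by metis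
qed

lemma pd_theta_eventually_shift:
  assumes "eventually (\<lambda>y. F y = f (y + s)) (nhds x)"
  shows "eventually (\<lambda>y. pd_theta F y = pd_theta f (y + s)) (nhds x)"
proof -
  have "eventually (\<lambda>y. eventually (\<lambda>y. F y = f (y + s)) (nhds y)) (nhds x)"
    using assms by (simp add: eventually_eventually)
  then show ?thesis
  proof eventually_elim
    case (elim y)
    have "((\<lambda>t. (t, snd y)) \<longlongrightarrow> (fst y, snd y)) (nhds (fst y))"
      by (intro tendsto_Pair tendsto_const filterlim_ident)
    then have "eventually (\<lambda>t. F (t, snd y) = f ((t, snd y) + s)) (nhds (fst y))"
      using elim by (auto dest: eventually_compose_filterlim)
    then have "deriv (\<lambda>t. F (t, snd y)) (fst y) = deriv (\<lambda>t. f ((t, snd y) + s)) (fst y)"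
      by (rule deriv_cong_ev) simp
    also have "\<dots> = deriv (\<lambda>t. f (t, snd y + snd s)) (fst y + fst s)"
      using deriv_shift[of "\<lambda>t. f (t, snd y + snd s)" "fst s"] by (cases s) simp
    finally show ?case by (cases y, cases s) (simp add: pd_theta_def)
  qed
qed

lemma pd_z_eventually_shift:
  assumes "eventually (\<lambda>y. F y = f (y + s)) (nhds x)"
  shows "eventually (\<lambda>y. pd_z F y = pd_z f (y + s)) (nhds x)"
proof -
  have "eventually (\<lambda>y. eventually (\<lambda>y. F y = f (y + s)) (nhds y)) (nhds x)"
    using assms by (simp add: eventually_eventually)
  then show ?thesis
  proof eventually_elim
    case (elim y)
    have "((\<lambda>t. (fst y, t)) \<longlongrightarrow> (fst y, snd y)) (nhds (snd y))"
      by (intro tendsto_Pair tendsto_const filterlim_ident)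
    then have "eventually (\<lambda>t. F (fst y, t) = f ((fst y, t) + s)) (nhds (snd y))"
      using elim by (auto dest: eventually_compose_filterlim)
    then have "deriv (\<lambda>t. F (fst y, t)) (snd y) = deriv (\<lambda>t. f ((fst y, t) + s)) (snd y)"
      by (rule deriv_cong_ev) simp
    also have "\<dots> = deriv (\<lambda>t. f (fst y + fst s, t)) (snd y + snd s)"
      using deriv_shift[of "\<lambda>t. f (fst y + fst s, t)" "snd s"] by (cases s) simp
    finally show ?case by (cases y, cases s) (simp add: pd_z_def)
  qed
qed

text \<open>
  Partial derivatives are local and commute with translations. Stating this for eventual equality
  near a point lets it be iterated, since such an equality also holds near all nearby points.
\<close>

lemma pd_eventually_shift:
  assumes "eventually (\<lambda>y. F y = f (y + s)) (nhds x)"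
  shows "eventually (\<lambda>y. pd i j F y = pd i j f (y + s)) (nhds x)"
proof -
  have "eventually (\<lambda>y. (pd_z ^^ j) F y = (pd_z ^^ j) f (y + s)) (nhds x)"
    by (induction j) (auto intro: assms pd_z_eventually_shift)
  then have "eventually (\<lambda>y. (pd_theta ^^ i) ((pd_z ^^ j) F) y = (pd_theta ^^ i) ((pd_z ^^ j) f) (y + s)) (nhds x)"
    by (induction i) (auto intro: pd_theta_eventually_shift)
  then show ?thesis by (simp add: pd_def)
qed

text \<open>
  Smoothness is a local property; the translation may vary from point to point.
\<close>

lemma smooth_local_shift:
  assumes f: "smooth f" and F: "\<And>x. \<exists>s. eventually (\<lambda>y. F y = f (y + s)) (nhds x)"
  shows "smooth F"
  unfolding smooth_def differentiable_on_def
proof (intro allI ballI)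
  fix i j and x :: "real \<times> real"
  obtain s where "eventually (\<lambda>y. F y = f (y + s)) (nhds x)" using F by blast
  then have ev: "eventually (\<lambda>y. pd i j f (y + s) = pd i j F y) (nhds x)"
    using pd_eventually_shift[of F f s x i j] by (auto elim: eventually_mono)
  have "pd i j f differentiable at (x + s)"
    using f unfolding smooth_def differentiable_on_def by blast
  then obtain D where D: "(pd i j f has_derivative D) (at (x + s))" by (auto simp: differentiable_def)
  have "((\<lambda>y. y + s) has_derivative (\<lambda>y. y)) (at x)"
    using has_derivative_add_const[OF has_derivative_ident] .
  from has_derivative_compose[OF this D]
  have "((\<lambda>y. pd i j f (y + s)) has_derivative (\<lambda>y. D y)) (at x)" .
  then have "(pd i j F has_derivative (\<lambda>y. D y)) (at x)"
  proof (rule has_derivative_transform_eventually)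
    show "eventually (\<lambda>y. pd i j f (y + s) = pd i j F y) (at x)"
      unfolding eventually_at_filter using ev by (rule eventually_mono) simp
    show "pd i j f (x + s) = pd i j F x" by (rule eventually_nhds_x_imp_x[OF ev])
  qed simp
  then show "pd i j F differentiable at x within UNIV"
    by (auto simp: differentiable_def)
qed

text \<open>
  The representative of \<open>t\<close> modulo \<open>p\<close> in the half-open interval from \<open>0\<close> to \<open>p\<close>.
\<close>

definition wrap :: "real \<Rightarrow> real \<Rightarrow> real" where
  "wrap p t = t - p * of_int \<lfloor>t / p\<rfloor>"

lemma wrap_periodic: assumes "p > 0" shows "wrap p (t + p) = wrap p t"
proof -
  have "(t + p) / p = t / p + 1" using assms by (simp add: field_simps)
  then have "\<lfloor>(t + p) / p\<rfloor> = \<lfloor>t / p\<rfloor> + 1" by simp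
  then show ?thesis by (simp add: wrap_def distrib_left)
qed

lemma wrap_id: "0 \<le> t \<Longrightarrow> t < p \<Longrightarrow> wrap p t = t"
proof -
  assume "0 \<le> t" "t < p"
  then have "\<lfloor>t / p\<rfloor> = 0" by (simp add: floor_eq_iff)
  then show ?thesis by (simp add: wrap_def)
qed

text \<open>
  Near \<open>t0\<close> the map \<open>wrap p\<close> is a fixed translation, except when a multiple of \<open>p\<close> is crossed; in that
  case both \<open>wrap p t\<close> and the translated point leave the part of the cell at distance \<open>\<delta>\<close> from its ends,
  so that functions supported in this part vanish at both.
\<close>

lemma wrap_local_shift:
  assumes p: "p > 0" and d: "\<delta> > 0"
  shows "\<exists>s. \<forall>t. \<bar>t - t0\<bar> < \<delta> \<longrightarrow> wrap p t = t + s \<or> wrap p t \<notin> {\<delta>..p - \<delta>} \<and> t + s \<notin> {\<delta>..p - \<delta>}"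
proof (intro exI allI impI)
  fix t assume t: "\<bar>t - t0\<bar> < \<delta>"
  define k0 where "k0 = \<lfloor>t0 / p\<rfloor>"
  define k where "k = \<lfloor>t / p\<rfloor>"
  have b0: "p * k0 \<le> t0" "t0 < p * (k0 + 1)"
    using floor_divide_lower[OF p, of t0] floor_divide_upper[OF p, of t0] by (simp_all add: k0_def mult.commute)
  have b: "p * k \<le> t" "t < p * (k + 1)"
    using floor_divide_lower[OF p, of t] floor_divide_upper[OF p, of t] by (simp_all add: k_def mult.commute)
  consider "k = k0" | "k0 + 1 \<le> k" | "k + 1 \<le> k0" by linarith
  then show "wrap p t = t + - (p * k0) \<or> wrap p t \<notin> {\<delta>..p - \<delta>} \<and> t + - (p * k0) \<notin> {\<delta>..p - \<delta>}"
  proof cases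
    case 1 then show ?thesis by (simp add: wrap_def k_def)
  next
    case 2
    then have "p * (real_of_int k0 + 1) \<le> p * k"
      using p by (intro mult_left_mono) linarith+
    moreover have "wrap p t = t - p * k" by (simp add: wrap_def k_def)
    ultimately show ?thesis using b b0 t d by (auto simp: algebra_simps)
  next
    case 3
    then have "p * (real_of_int k + 1) \<le> p * k0"
      using p by (intro mult_left_mono) linarith+
    moreover have "wrap p t = t - p * k" by (simp add: wrap_def k_def)
    ultimately show ?thesis using b b0 t d by (auto simp: algebra_simps)
  qed
qed

text \<open>
  The axial variable is shifted by \<open>1/2\<close> because its cell is centred at the origin.
\<close>

definition periodize :: "(real \<times> real \<Rightarrow> real) \<Rightarrow> real \<times> real \<Rightarrow> real" where
  "periodize f = (\<lambda>(\<theta>, z). f (wrap (2 * pi) \<theta>, wrap 1 (z + 1/2) - 1/2))"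

lemma periodize_eq: "x \<in> interior Omega \<Longrightarrow> periodize f x = f x"
proof -
  assume "x \<in> interior Omega"
  then obtain \<theta> z where x: "x = (\<theta>, z)" "0 < \<theta>" "\<theta> < 2 * pi" "-(1/2) < z" "z < 1/2"
    unfolding interior_Omega by auto
  then have "wrap (2 * pi) \<theta> = \<theta>" "wrap 1 (z + 1/2) = z + 1/2"
    by (intro wrap_id; linarith)+
  then show ?thesis by (simp add: x(1) periodize_def)
qed

lemma Omega_periodic_periodize: "Omega_periodic (periodize f)"
proof -
  have "wrap 1 (z + 1 + 1/2) = wrap 1 (z + 1/2)" for z
    using wrap_periodic[of 1 "z + 1/2"] by (simp add: add.commute add.left_commute)
  then show ?thesis by (simp add: Omega_periodic_def periodize_def wrap_periodic)
qed

lemma compact_in_open_interval: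
  assumes "compact K" "K \<subseteq> {a<..<b::real}"
  shows "\<exists>\<delta>>0. K \<subseteq> {a + \<delta>..b - \<delta>}"
proof (cases "K = {}")
  case False
  obtain l where l: "l \<in> K" "\<And>x. x \<in> K \<Longrightarrow> l \<le> x" using compact_attains_inf[OF assms(1) False] by blast
  obtain u where u: "u \<in> K" "\<And>x. x \<in> K \<Longrightarrow> x \<le> u" using compact_attains_sup[OF assms(1) False] by blast
  define \<delta> where "\<delta> = min (l - a) (b - u)"
  have "a < l" "u < b" using l(1) u(1) assms(2) by auto
  then have "\<delta> > 0" by (simp add: \<delta>_def)
  moreover have "x \<in> {a + \<delta>..b - \<delta>}" if "x \<in> K" for x
    using l(2)[OF that] u(2)[OF that] unfolding \<delta>_def by (simp add: min_def)
  ultimately show ?thesis by blast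
next
  case True
  then show ?thesis by (intro exI[of _ 1]) simp
qed

text \<open>
  The support is compact, so its two projections stay away from the ends of the intervals.
\<close>

lemma interior_tests_margin:
  assumes "\<psi> \<in> interior_tests"
  shows "\<exists>\<delta>>0. \<forall>\<theta> z. \<psi> (\<theta>, z) \<noteq> 0 \<longrightarrow> \<theta> \<in> {\<delta>..2 * pi - \<delta>} \<and> z \<in> {-(1/2) + \<delta>..1/2 - \<delta>}"
proof -
  let ?K = "closure {x. \<psi> x \<noteq> 0}"
  have K: "?K \<subseteq> {0<..<2 * pi} \<times> {-(1/2)<..<1/2}"
    using assms by (simp add: interior_tests_def interior_Omega)
  have "bounded ?K"
    by (rule bounded_subset[OF _ K]) (intro bounded_Times, auto)
  then have c: "compact ?K" by (simp add: compact_eq_bounded_closed)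
  have "compact (fst ` ?K)" "compact (snd ` ?K)"
    by (rule compact_continuous_image[OF _ c], intro continuous_intros)+
  note cf = this
  have sf: "fst ` ?K \<subseteq> {0<..<2 * pi}" "snd ` ?K \<subseteq> {-(1/2)<..<1/2}" using K by auto
  note ex = compact_in_open_interval[OF cf(1) sf(1)] compact_in_open_interval[OF cf(2) sf(2)]
  obtain \<delta> where d: "\<delta> > 0" "fst ` ?K \<subseteq> {0 + \<delta>..2 * pi - \<delta>}" using ex(1) by (elim exE conjE)
  obtain \<epsilon> where e: "\<epsilon> > 0" "snd ` ?K \<subseteq> {-(1/2) + \<epsilon>..1/2 - \<epsilon>}" using ex(2) by (elim exE conjE)
  have "\<theta> \<in> {min \<delta> \<epsilon>..2 * pi - min \<delta> \<epsilon>} \<and> z \<in> {-(1/2) + min \<delta> \<epsilon>..1/2 - min \<delta> \<epsilon>}" if "\<psi> (\<theta>, z) \<noteq> 0" for \<theta> z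
  proof -
    have "(\<theta>, z) \<in> ?K" by (rule subsetD[OF closure_subset]) (simp add: that)
    then have "\<theta> \<in> fst ` ?K" "z \<in> snd ` ?K" by (auto intro: rev_image_eqI)
    then have "\<theta> \<in> {0 + \<delta>..2 * pi - \<delta>}" "z \<in> {-(1/2) + \<epsilon>..1/2 - \<epsilon>}"
      using subsetD[OF d(2), of \<theta>] subsetD[OF e(2), of z] by simp_all
    then show ?thesis by (simp add: min_def)
  qed
  then have "\<forall>\<theta> z. \<psi> (\<theta>, z) \<noteq> 0 \<longrightarrow> \<theta> \<in> {min \<delta> \<epsilon>..2 * pi - min \<delta> \<epsilon>} \<and>
      z \<in> {-(1/2) + min \<delta> \<epsilon>..1/2 - min \<delta> \<epsilon>}" by blast
  moreover have "min \<delta> \<epsilon> > 0" using d e by simp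
  ultimately show ?thesis by blast
qed

lemma eventually_nhds_strip:
  assumes "\<delta> > 0"
  shows "eventually (\<lambda>y. \<bar>fst y - fst x\<bar> < \<delta> \<and> \<bar>snd y - snd (x :: real \<times> real)\<bar> < \<delta>) (nhds x)"
proof -
  have "(fst \<longlongrightarrow> fst x) (nhds x)" "(snd \<longlongrightarrow> snd x) (nhds x)"
    by (auto intro!: tendsto_fst tendsto_snd filterlim_ident)
  from eventually_conj[OF tendstoD[OF this(1) assms] tendstoD[OF this(2) assms]]
  show ?thesis by (simp add: dist_real_def)
qed

lemma periodize_per_tests:
  assumes "\<psi> \<in> interior_tests" shows "periodize \<psi> \<in> per_tests"
proof -
  obtain \<delta> where d: "\<delta> > 0"
    and supp: "\<And>\<theta> z. \<psi> (\<theta>, z) \<noteq> 0 \<Longrightarrow> \<theta> \<in> {\<delta>..2 * pi - \<delta>} \<and> z \<in> {-(1/2) + \<delta>..1/2 - \<delta>}"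
    using interior_tests_margin[OF assms] by blast
  have "\<exists>s. eventually (\<lambda>y. periodize \<psi> y = \<psi> (y + s)) (nhds x)" for x
  proof -
    obtain s where s: "\<And>t. \<bar>t - fst x\<bar> < \<delta> \<Longrightarrow> wrap (2*pi) t = t + s \<or>
        wrap (2*pi) t \<notin> {\<delta>..2*pi - \<delta>} \<and> t + s \<notin> {\<delta>..2*pi - \<delta>}"
      using wrap_local_shift[of "2*pi" \<delta> "fst x"] d by auto
    obtain s' where s': "\<And>t. \<bar>t - (snd x + 1/2)\<bar> < \<delta> \<Longrightarrow> wrap 1 t = t + s' \<or>
        wrap 1 t \<notin> {\<delta>..1 - \<delta>} \<and> t + s' \<notin> {\<delta>..1 - \<delta>}"
      using wrap_local_shift[of 1 \<delta> "snd x + 1/2"] d by auto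
    have "eventually (\<lambda>y. periodize \<psi> y = \<psi> (y + (s, s'))) (nhds x)"
      using eventually_nhds_strip[OF d, of x]
    proof eventually_elim
      case (elim y)
      obtain \<theta> z where y: "y = (\<theta>, z)" by force
      have A: "wrap (2*pi) \<theta> = \<theta> + s \<or> wrap (2*pi) \<theta> \<notin> {\<delta>..2*pi - \<delta>} \<and> \<theta> + s \<notin> {\<delta>..2*pi - \<delta>}"
        using s[of \<theta>] elim y by auto
      have "wrap 1 (z + 1/2) = z + 1/2 + s' \<or> wrap 1 (z + 1/2) \<notin> {\<delta>..1 - \<delta>} \<and> z + 1/2 + s' \<notin> {\<delta>..1 - \<delta>}"
        using s'[of "z + 1/2"] elim y by auto
      then have B: "wrap 1 (z + 1/2) - 1/2 = z + s' \<or>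
          wrap 1 (z + 1/2) - 1/2 \<notin> {-(1/2) + \<delta>..1/2 - \<delta>} \<and> z + s' \<notin> {-(1/2) + \<delta>..1/2 - \<delta>}"
        by auto
      have "\<psi> (wrap (2*pi) \<theta>, wrap 1 (z + 1/2) - 1/2) = \<psi> (\<theta> + s, z + s')"
        using A B supp by metis
      then show ?case by (simp add: y periodize_def)
    qed
    then show ?thesis by blast
  qed
  then have "smooth (periodize \<psi>)"
    using assms smooth_local_shift[of \<psi> "periodize \<psi>"] by (auto simp: interior_tests_def)
  then show ?thesis using Omega_periodic_periodize by (simp add: per_tests_def)
qed

text \<open>
  Periodic tests that depend on the angle only: they isolate slices of constant angle and exist
  because periodicity in \<open>z\<close> places no restriction on functions constant in \<open>z\<close>.
\<close>

lemma theta_test_per_tests: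
  assumes a: "a \<in> tests1 0 (2 * pi)"
  shows "(\<lambda>(\<theta>, z). a (wrap (2 * pi) \<theta>)) \<in> per_tests"
proof -
  obtain \<delta> where d: "\<delta> > 0" "\<And>x. x \<notin> {\<delta>..2 * pi - \<delta>} \<Longrightarrow> a x = 0"
  proof -
    have "\<exists>\<delta>>0. \<forall>x. x \<notin> {0 + \<delta>..2 * pi - \<delta>} \<longrightarrow> a x = 0"
      using a unfolding tests1_def mem_Collect_eq by (rule conjunct2)
    then show thesis using that unfolding add_0 by blast
  qed
  let ?F = "\<lambda>(\<theta>, z::real). a (wrap (2 * pi) \<theta>)"
  have "\<exists>s. eventually (\<lambda>y. ?F y = tensor a (\<lambda>z. 1) (y + s)) (nhds x)" for x
  proof -
    obtain s where s: "\<And>t. \<bar>t - fst x\<bar> < \<delta> \<Longrightarrow> wrap (2*pi) t = t + s \<or>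
        wrap (2*pi) t \<notin> {\<delta>..2*pi - \<delta>} \<and> t + s \<notin> {\<delta>..2*pi - \<delta>}"
      using wrap_local_shift[of "2*pi" \<delta> "fst x"] d by auto
    have "eventually (\<lambda>y. ?F y = tensor a (\<lambda>z. 1) (y + (s, 0))) (nhds x)"
      using eventually_nhds_strip[OF d(1), of x]
    proof eventually_elim
      case (elim y)
      then have "wrap (2*pi) (fst y) = fst y + s \<or>
        wrap (2*pi) (fst y) \<notin> {\<delta>..2*pi - \<delta>} \<and> fst y + s \<notin> {\<delta>..2*pi - \<delta>}"
        using s by auto
      then have "a (wrap (2*pi) (fst y)) = a (fst y + s)" using d(2) by metis
      then show ?case by (cases y) (simp add: tensor_def)
    qed
    then show ?thesis by blast
  qed
  then have "smooth ?F"
    using smooth_tensor[OF tests1_smooth1[OF a] smooth1_const[of 1]] smooth_local_shift by blast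
  moreover have "Omega_periodic ?F" by (simp add: Omega_periodic_def wrap_periodic)
  ultimately show ?thesis by (simp add: per_tests_def)
qed

text \<open>
  The periodic extension of an interior test is a periodic test and agrees with the original one,
  together with all derivatives, in the interior of \<^const>\<open>Omega\<close>, hence almost everywhere.
\<close>

lemma per_weak_deriv_imp_interior:
  assumes w: "has_weak_deriv per_tests i j f g" and "f \<in> L2" "g \<in> L2"
  shows "has_weak_deriv interior_tests i j f g"
  unfolding has_weak_deriv_def
proof
  fix \<psi> assume psi: "\<psi> \<in> interior_tests"
  then have P: "periodize \<psi> \<in> per_tests" by (rule periodize_per_tests)
  have AE: "AE x in Omega_measure. pd k l (periodize \<psi>) x = pd k l \<psi> x" for k l
    using AE_interior_Omega
  proof eventually_elim
    case (elim x)
    then have "eventually (\<lambda>y. y \<in> interior Omega) (nhds x)"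
      by (intro eventually_nhds_in_open) auto
    then have "eventually (\<lambda>y. periodize \<psi> y = \<psi> (y + 0)) (nhds x)"
      by eventually_elim (simp add: periodize_eq)
    from pd_eventually_shift[OF this, THEN eventually_nhds_x_imp_x] show ?case by simp
  qed
  have L: "pd k l (periodize \<psi>) \<in> L2" "pd k l \<psi> \<in> L2" for k l
    using psi P by (auto simp: per_tests_def interior_tests_def intro: smooth_pd_L2)
  have eq: "(LINT x|Omega_measure. u x * pd k l (periodize \<psi>) x) = (LINT x|Omega_measure. u x * pd k l \<psi> x)"
    if "u \<in> L2" for u k l
  proof (rule integral_cong_AE)
    show "(\<lambda>x. u x * pd k l (periodize \<psi>) x) \<in> borel_measurable Omega_measure"
      "(\<lambda>x. u x * pd k l \<psi> x) \<in> borel_measurable Omega_measure"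
      using that L by (auto simp: L2_def intro!: borel_measurable_times)
    show "AE x in Omega_measure. u x * pd k l (periodize \<psi>) x = u x * pd k l \<psi> x"
      using AE[of k l] by eventually_elim simp
  qed
  have "(LINT x|Omega_measure. f x * pd i j (periodize \<psi>) x)
      = (-1) ^ (i + j) * (LINT x|Omega_measure. g x * periodize \<psi> x)"
    using w P by (simp add: has_weak_deriv_def)
  then show "(LINT x|Omega_measure. f x * pd i j \<psi> x) = (-1) ^ (i + j) * (LINT x|Omega_measure. g x * \<psi> x)"
    using eq[of f i j] eq[of g 0 0] assms by (simp add: pd_def)
qed

section \<open>Weak derivatives of affine functions\<close>

interpretation pair_sigma_finite M_theta M_z
  using finite_M_theta finite_M_z by (simp add: pair_sigma_finite_def finite_measure_def)

lemma interior_tests_boundary: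
  assumes "\<psi> \<in> interior_tests" "(\<theta>, z) \<notin> interior Omega" shows "\<psi> (\<theta>, z) = 0"
proof (rule ccontr)
  assume "\<psi> (\<theta>, z) \<noteq> 0"
  then have "(\<theta>, z) \<in> closure {x. \<psi> x \<noteq> 0}" using closure_subset[of "{x. \<psi> x \<noteq> 0}"] by auto
  then show False using assms by (auto simp: interior_tests_def)
qed

text \<open>
  Identifies the derivatives in the definition of the tests with honest partial derivatives.
\<close>

lemma smooth_partial_derivs:
  assumes "smooth \<psi>"
  shows "((\<lambda>t. \<psi> (t, z)) has_real_derivative pd 1 0 \<psi> (\<theta>, z)) (at \<theta>)"
    and "((\<lambda>t. \<psi> (\<theta>, t)) has_real_derivative pd 0 1 \<psi> (\<theta>, z)) (at z)"
proof -
  have "pd 0 0 \<psi> differentiable_on UNIV" using assms unfolding smooth_def by blast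
  then have d: "\<psi> differentiable at (\<theta>, z)" by (simp add: pd_def differentiable_on_def)
  have "(\<lambda>t. \<psi> (t, z)) differentiable at \<theta>"
    using differentiable_chain_at[of "\<lambda>t. (t, z)" \<theta> \<psi>] d
    by (simp add: o_def differentiable_Pair)
  then show "((\<lambda>t. \<psi> (t, z)) has_real_derivative pd 1 0 \<psi> (\<theta>, z)) (at \<theta>)"
    unfolding real_differentiable_def by (auto simp: pd_def pd_theta_def DERIV_imp_deriv)
  have "(\<lambda>t. \<psi> (\<theta>, t)) differentiable at z"
    using differentiable_chain_at[of "\<lambda>t. (\<theta>, t)" z \<psi>] d
    by (simp add: o_def differentiable_Pair)
  then show "((\<lambda>t. \<psi> (\<theta>, t)) has_real_derivative pd 0 1 \<psi> (\<theta>, z)) (at z)"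
    unfolding real_differentiable_def by (auto simp: pd_def pd_z_def DERIV_imp_deriv)
qed

lemma smooth_pd_continuous: "smooth \<psi> \<Longrightarrow> continuous_on UNIV (pd i j \<psi>)"
  by (simp add: smooth_def differentiable_imp_continuous_on)

lemma integral_Icc_deriv_0:
  fixes G :: "real \<Rightarrow> real"
  assumes "a \<le> b" "\<And>x. (G has_real_derivative g x) (at x)" "continuous_on UNIV g" "G a = G b"
  shows "(LINT x|restrict_space lborel {a..b}. g x) = 0"
proof -
  have "(LINT x|lborel. g x * indicator {a..b} x) = G b - G a"
    using assms by (intro integral_FTC_Icc_real) (auto simp: continuous_on_eq_continuous_at)
  then show ?thesis
    using assms by (subst integral_restrict_space) (auto simp: mult.commute)
qed

text \<open>
  On every vertical slice the integrand \<open>\<psi> + z * pd 0 1 \<psi>\<close> is the derivative of \<open>z * \<psi>\<close>, which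
  vanishes at both ends.
\<close>

lemma weak_deriv_snd_z: "has_weak_deriv interior_tests 0 1 snd (\<lambda>x. 1)"
  unfolding has_weak_deriv_def
proof
  fix \<psi> assume psi: "\<psi> \<in> interior_tests"
  then have sm: "smooth \<psi>" by (simp add: interior_tests_def)
  have "(snd :: real \<times> real \<Rightarrow> real) \<in> L2" by (intro continuous_L2 continuous_intros)
  then have i: "integrable Omega_measure (\<lambda>x. snd x * pd 0 1 \<psi> x)" "integrable Omega_measure \<psi>"
    using sm by (auto intro: L2_mult_integrable smooth_pd_L2 L2_integrable smooth_L2)
  then have "integrable Omega_measure (\<lambda>x. \<psi> x + snd x * pd 0 1 \<psi> x)" by simp
  then have "(LINT x|Omega_measure. \<psi> x + snd x * pd 0 1 \<psi> x)
    = (LINT \<theta>|M_theta. LINT z|M_z. \<psi> (\<theta>, z) + z * pd 0 1 \<psi> (\<theta>, z))"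
    unfolding Omega_measure_eq by (subst integral_fst'[symmetric]) auto
  also have "\<dots> = (LINT \<theta>|M_theta. 0)"
  proof (rule Bochner_Integration.integral_cong[OF refl])
    fix \<theta>
    have c: "continuous_on UNIV (\<lambda>z. \<psi> (\<theta>, z))" "continuous_on UNIV (\<lambda>z. pd 0 1 \<psi> (\<theta>, z))"
      using smooth_pd_continuous[OF sm, of 0 0] smooth_pd_continuous[OF sm, of 0 1]
      by (auto simp: pd_def intro!: continuous_on_compose2[of UNIV _ UNIV "Pair \<theta>"] continuous_intros)
    show "(LINT z|M_z. \<psi> (\<theta>, z) + z * pd 0 1 \<psi> (\<theta>, z)) = 0"
    proof (rule integral_Icc_deriv_0[where G = "\<lambda>z. z * \<psi> (\<theta>, z)"])
      show "((\<lambda>z. z * \<psi> (\<theta>, z)) has_real_derivative \<psi> (\<theta>, z) + z * pd 0 1 \<psi> (\<theta>, z)) (at z)" for z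
        using DERIV_mult[OF DERIV_ident smooth_partial_derivs(2)[OF sm, of \<theta> z]] by (simp add: mult.commute)
      show "-(1/2) * \<psi> (\<theta>, -(1/2)) = 1/2 * \<psi> (\<theta>, 1/2)"
        using interior_tests_boundary[OF psi] by (simp add: interior_Omega)
      show "continuous_on UNIV (\<lambda>z. \<psi> (\<theta>, z) + z * pd 0 1 \<psi> (\<theta>, z))"
        using c by (intro continuous_intros)
    qed simp
  qed
  finally have "(LINT x|Omega_measure. \<psi> x) + (LINT x|Omega_measure. snd x * pd 0 1 \<psi> x) = 0"
    using i by simp
  then show "(LINT x|Omega_measure. snd x * pd 0 1 \<psi> x) = (-1) ^ (0 + 1) * (LINT x|Omega_measure. 1 * \<psi> x)"
    by simp
qed

lemma weak_deriv_snd_theta: "has_weak_deriv interior_tests 1 0 snd (\<lambda>x. 0)"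
  unfolding has_weak_deriv_def
proof
  fix \<psi> assume psi: "\<psi> \<in> interior_tests"
  then have sm: "smooth \<psi>" by (simp add: interior_tests_def)
  have "(snd :: real \<times> real \<Rightarrow> real) \<in> L2" by (intro continuous_L2 continuous_intros)
  then have i: "integrable Omega_measure (\<lambda>x. snd x * pd 1 0 \<psi> x)"
    using sm by (auto intro: L2_mult_integrable smooth_pd_L2)
  then have "(LINT x|Omega_measure. snd x * pd 1 0 \<psi> x)
    = (LINT z|M_z. LINT \<theta>|M_theta. z * pd 1 0 \<psi> (\<theta>, z))"
    unfolding Omega_measure_eq by (subst integral_snd) (auto simp: case_prod_beta')
  also have "\<dots> = (LINT z|M_z. 0)"
  proof (rule Bochner_Integration.integral_cong[OF refl])
    fix z
    have c: "continuous_on UNIV (\<lambda>\<theta>. pd 1 0 \<psi> (\<theta>, z))"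
      using smooth_pd_continuous[OF sm, of 1 0]
      by (auto intro!: continuous_on_compose2[of UNIV _ UNIV "\<lambda>\<theta>. (\<theta>, z)"] continuous_intros)
    show "(LINT \<theta>|M_theta. z * pd 1 0 \<psi> (\<theta>, z)) = 0"
    proof (rule integral_Icc_deriv_0[where G = "\<lambda>\<theta>. z * \<psi> (\<theta>, z)"])
      show "((\<lambda>\<theta>. z * \<psi> (\<theta>, z)) has_real_derivative z * pd 1 0 \<psi> (\<theta>, z)) (at \<theta>)" for \<theta>
        by (rule DERIV_cmult[OF smooth_partial_derivs(1)[OF sm]])
      show "z * \<psi> (0, z) = z * \<psi> (2 * pi, z)"
        using interior_tests_boundary[OF psi] by (simp add: interior_Omega)
      show "continuous_on UNIV (\<lambda>\<theta>. z * pd 1 0 \<psi> (\<theta>, z))"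
        using c by (intro continuous_intros)
    qed simp
  qed
  finally show "(LINT x|Omega_measure. snd x * pd 1 0 \<psi> x) = (-1) ^ (1 + 0) * (LINT x|Omega_measure. 0 * \<psi> x)"
    by simp
qed

text \<open>
  Used to pass between the axial displacement, which is not periodic, and the periodic function
  obtained by adding \<open>lam * z\<close>.
\<close>

lemma has_weak_deriv_lincomb:
  assumes "has_weak_deriv interior_tests i j f g" "has_weak_deriv interior_tests i j f' g'"
    and L: "f \<in> L2" "g \<in> L2" "f' \<in> L2" "g' \<in> L2"
  shows "has_weak_deriv interior_tests i j (\<lambda>x. f x + c * f' x) (\<lambda>x. g x + c * g' x)"
  unfolding has_weak_deriv_def
proof
  fix \<psi> assume psi: "\<psi> \<in> interior_tests"
  then have sm: "smooth \<psi>" by (simp add: interior_tests_def)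
  note I = L2_mult_integrable[OF _ smooth_pd_L2[OF sm]] L2_mult_integrable[OF _ smooth_L2[OF sm]]
  have "(LINT x|Omega_measure. (f x + c * f' x) * pd i j \<psi> x)
      = (LINT x|Omega_measure. f x * pd i j \<psi> x) + c * (LINT x|Omega_measure. f' x * pd i j \<psi> x)"
    using I L by (simp add: distrib_right mult.assoc)
  moreover have "(LINT x|Omega_measure. (g x + c * g' x) * \<psi> x)
      = (LINT x|Omega_measure. g x * \<psi> x) + c * (LINT x|Omega_measure. g' x * \<psi> x)"
    using I L by (simp add: distrib_right mult.assoc)
  ultimately show "(LINT x|Omega_measure. (f x + c * f' x) * pd i j \<psi> x)
      = (-1) ^ (i + j) * (LINT x|Omega_measure. (g x + c * g' x) * \<psi> x)"
    using assms(1,2) psi by (simp add: has_weak_deriv_def distrib_left)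
qed

section \<open>Slices in the axial direction\<close>

lemma prob_space_M_z: "prob_space M_z"
  by (rule prob_spaceI) (simp add: emeasure_restrict_space)

lemma id_measurable_M_z [measurable]: "(\<lambda>x. x) \<in> M_z \<rightarrow>\<^sub>M borel"
  by (rule measurable_restrict_space1) simp

lemma tests1_measurable: "a \<in> tests1 s t \<Longrightarrow> a \<in> borel_measurable borel"
  by (intro borel_measurable_continuous_onI smooth1_continuous tests1_smooth1)

lemma tests1_bounded:
  assumes "a \<in> tests1 s t" shows "\<exists>K. \<forall>x. \<bar>a x\<bar> \<le> K"
proof -
  have "bounded (a ` {s..t})"
    using assms by (intro compact_imp_bounded compact_continuous_image smooth1_continuous tests1_smooth1) auto
  then obtain K where K: "\<And>x. x \<in> {s..t} \<Longrightarrow> \<bar>a x\<bar> \<le> K" unfolding bounded_iff real_norm_def by blast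
  have "\<bar>a x\<bar> \<le> max K 0" for x
  proof (cases "x \<in> {s..t}")
    case True then show ?thesis using K[of x] by simp
  next
    case False then have "a x = 0" using tests1_zero[OF assms, of x] by auto
    then show ?thesis by simp
  qed
  then show ?thesis by blast
qed

lemma tests1_lincomb:
  assumes "a \<in> tests1 s t" "b \<in> tests1 s t" shows "(\<lambda>x. a x + c * b x) \<in> tests1 s t"
proof -
  obtain \<delta> where d: "\<delta> > 0" "\<forall>x. x \<notin> {s + \<delta>..t - \<delta>} \<longrightarrow> a x = 0" using assms(1) unfolding tests1_def by auto
  obtain \<epsilon> where e: "\<epsilon> > 0" "\<forall>x. x \<notin> {s + \<epsilon>..t - \<epsilon>} \<longrightarrow> b x = 0" using assms(2) unfolding tests1_def by auto
  have "a x + c * b x = 0" if "x \<notin> {s + min \<delta> \<epsilon>..t - min \<delta> \<epsilon>}" for x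
  proof -
    have "x \<notin> {s + \<delta>..t - \<delta>}" "x \<notin> {s + \<epsilon>..t - \<epsilon>}" using that by auto
    then show ?thesis using d e by simp
  qed
  moreover have "smooth1 (\<lambda>x. a x + c * b x)"
    using assms by (intro smooth1_add smooth1_mult smooth1_const tests1_smooth1)
  moreover have "min \<delta> \<epsilon> > 0" using d e by simp
  ultimately show ?thesis unfolding tests1_def by blast
qed

lemma integrable_mult_tensor:
  assumes r: "integrable Omega_measure r" and ab: "a \<in> tests1 s t" "b \<in> tests1 s' t'"
  shows "integrable Omega_measure (\<lambda>x. r x * tensor a b x)"
proof -
  obtain K where K: "\<And>x. \<bar>a x\<bar> \<le> K" using tests1_bounded[OF ab(1)] by blast
  obtain L where L: "\<And>x. \<bar>b x\<bar> \<le> L" using tests1_bounded[OF ab(2)] by blast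
  have "tensor a b \<in> borel_measurable Omega_measure"
    using ab by (intro measurable_restrict_space1)
      (simp add: borel_measurable_continuous_onI continuous_on_tensor tests1_smooth1)
  moreover have "\<bar>tensor a b x\<bar> \<le> K * L" for x
    using K[of "fst x"] L[of "snd x"] abs_ge_zero[of "a (fst x)"]
    by (auto simp: tensor_def case_prod_beta' abs_mult intro!: mult_mono)
  then have "norm (r x * tensor a b x) \<le> norm ((K * L) * r x)" for x
    using mult_right_mono[of "\<bar>tensor a b x\<bar>" "\<bar>K * L\<bar>" "\<bar>r x\<bar>"] abs_ge_self[of "K * L"]
    by (simp add: abs_mult mult.commute) (metis abs_mult mult.commute order_trans)
  ultimately show ?thesis
  proof (intro Bochner_Integration.integrable_bound[of _ "\<lambda>x. (K * L) * r x" "\<lambda>x. r x * tensor a b x"])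
    show "integrable Omega_measure (\<lambda>x. (K * L) * r x)" using r by simp
  qed (use r in \<open>simp_all add: borel_measurable_integrable\<close>)
qed

text \<open>
  The measure on the vertical interval has total mass one.
\<close>

lemma integrable_comp_fst:
  fixes c :: "real \<Rightarrow> real"
  assumes c: "integrable M_theta c" shows "integrable Omega_measure (\<lambda>x. c (fst x))"
proof -
  interpret z: prob_space M_z by (rule prob_space_M_z)
  have [measurable]: "c \<in> borel_measurable M_theta" using c by simp
  show ?thesis unfolding Omega_measure_eq
    by (rule Fubini_integrable) (use c in \<open>simp_all add: z.prob_space\<close>)
qed

lemma integral_Omega_iterated:
  fixes f :: "real \<times> real \<Rightarrow> real"
  assumes "integrable Omega_measure f"
  shows "(LINT x|Omega_measure. f x) = (LINT \<theta>|M_theta. LINT z|M_z. f (\<theta>, z))"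
  using assms unfolding Omega_measure_eq by (rule integral_fst'[symmetric])

lemma AE_slices:
  assumes "AE x in Omega_measure. P x" shows "AE \<theta> in M_theta. AE z in M_z. P (\<theta>, z)"
  using assms unfolding Omega_measure_eq by (rule AE_pair)

lemma AE_slice_integrable:
  fixes f :: "real \<times> real \<Rightarrow> real"
  assumes "integrable Omega_measure f" shows "AE \<theta> in M_theta. integrable M_z (\<lambda>z. f (\<theta>, z))"
  using assms unfolding Omega_measure_eq by (rule AE_integrable_fst')

lemma integrable_slice_integral:
  fixes f :: "real \<times> real \<Rightarrow> real"
  assumes "integrable Omega_measure f" shows "integrable M_theta (\<lambda>\<theta>. LINT z|M_z. f (\<theta>, z))"
  using assms unfolding Omega_measure_eq by (rule integrable_fst')

lemma tests1_integral_Icc: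
  assumes "b \<in> tests1 (-(1/2)) (1/2)"
  shows "(LINT z|M_z. b z) = integral {-(1/2)..1/2} b"
proof -
  have "set_integrable lborel {-(1/2)..1/2} b"
    using assms by (intro borel_integrable_atLeastAtMost' smooth1_continuous tests1_smooth1)
  from set_borel_integral_eq_integral(2)[OF this] show ?thesis
    by (subst integral_restrict_space) (simp_all add: set_lebesgue_integral_def)
qed

text \<open>
  Otherwise all products of tests would have integral zero and the fundamental lemma would show that
  the constant \<open>1\<close> vanishes almost everywhere.
\<close>

lemma ex_tests1_integral_nonzero: "\<exists>b \<in> tests1 (-(1/2)) (1/2). (LINT z|M_z. b z) \<noteq> 0"
proof (rule ccontr)
  assume "\<not> ?thesis"
  then have 0: "(LINT z|M_z. b z) = 0" if "b \<in> tests1 (-(1/2)) (1/2)" for b using that by blast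
  have one: "integrable Omega_measure (\<lambda>x. 1::real)" by (rule L2_integrable[OF const_L2])
  have "AE x in Omega_measure. (1::real) = 0"
  proof (rule fundamental_lemma[OF one])
    fix a b assume ab: "a \<in> tests1 0 (2 * pi)" "b \<in> tests1 (-(1/2)) (1/2)"
    have "(LINT x|Omega_measure. 1 * tensor a b x) = (LINT \<theta>|M_theta. LINT z|M_z. a \<theta> * b z)"
      using integral_Omega_iterated[OF integrable_mult_tensor[OF one ab]] by (simp add: tensor_def)
    also have "\<dots> = 0" using 0[OF ab(2)] by simp
    finally show "(LINT x|Omega_measure. 1 * tensor a b x) = 0" .
  qed
  then have "AE x in Omega_measure. False" by simp
  then have "ae_filter Omega_measure = bot"
    by (simp add: trivial_limit_def)
  then show False by (simp add: ae_filter_eq_bot_iff space_Omega_measure emeasure_Omega)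
qed

definition primitive_z :: "(real \<times> real \<Rightarrow> real) \<Rightarrow> real \<times> real \<Rightarrow> real" where
  "primitive_z g x = (LINT s|M_z. indicator {..snd x} s * g (fst x, s))"

lemma primitive_z_integrable:
  assumes g: "integrable Omega_measure g"
  shows "integrable Omega_measure (primitive_z g)"
proof -
  interpret z: prob_space M_z by (rule prob_space_M_z)
  have gm [measurable]: "g \<in> borel_measurable (M_theta \<Otimes>\<^sub>M M_z)"
    using g unfolding Omega_measure_eq by simp
  have "(\<lambda>x. LINT s|M_z. (if s \<le> snd x then 1 else 0) * g (fst x, s)) \<in> borel_measurable (M_theta \<Otimes>\<^sub>M M_z)"
    by measurable
  moreover have eq: "primitive_z g = (\<lambda>x. LINT s|M_z. (if s \<le> snd x then 1 else 0) * g (fst x, s))"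
    unfolding primitive_z_def by (auto simp: fun_eq_iff intro!: Bochner_Integration.integral_cong)
  ultimately have m: "primitive_z g \<in> borel_measurable Omega_measure"
    unfolding Omega_measure_eq by simp
  have N: "integrable Omega_measure (\<lambda>x. LINT s|M_z. \<bar>g (fst x, s)\<bar>)"
    by (rule integrable_comp_fst[OF integrable_slice_integral]) (use g in simp)
  show ?thesis
  proof (rule Bochner_Integration.integrable_bound[OF N m])
    have "AE x in M_theta \<Otimes>\<^sub>M M_z. integrable M_z (\<lambda>s. g (fst x, s))"
      using AE_slice_integrable[OF g] by (intro AE_pair_measure) (auto, measurable)
    then show "AE x in Omega_measure. norm (primitive_z g x) \<le> norm (LINT s|M_z. \<bar>g (fst x, s)\<bar>)"
      unfolding Omega_measure_eq
    proof eventually_elim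
      case (elim x)
      have "norm (primitive_z g x) \<le> (LINT s|M_z. norm (indicator {..snd x} s * g (fst x, s)))"
        unfolding primitive_z_def by (rule integral_norm_bound)
      also have "\<dots> \<le> (LINT s|M_z. \<bar>g (fst x, s)\<bar>)"
      proof (rule integral_mono)
        have [measurable]: "(\<lambda>s. g (fst x, s)) \<in> borel_measurable M_z" using elim by simp
        show i: "integrable M_z (\<lambda>s. \<bar>g (fst x, s)\<bar>)" using elim by simp
        show "integrable M_z (\<lambda>s. norm (indicator {..snd x} s * g (fst x, s)))"
          by (rule Bochner_Integration.integrable_bound[OF i]) (auto simp: indicator_def)
      qed (auto simp: indicator_def)
      finally show ?case by simp
    qed
  qed
qed

text \<open>
  Fubini on the triangle \<open>s \<le> z\<close>: the inner integral of \<open>deriv b\<close> from \<open>s\<close> to the upper end is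
  \<open>- b s\<close>, as \<open>b\<close> vanishes at the end.
\<close>

lemma integration_by_parts_slice:
  assumes g: "integrable M_z g" and b: "b \<in> tests1 (-(1/2)) (1/2)"
  shows "(LINT z|M_z. (LINT s|M_z. indicator {..z} s * g s) * deriv b z) = - (LINT s|M_z. g s * b s)"
proof -
  interpret z: prob_space M_z by (rule prob_space_M_z)
  interpret zz: pair_sigma_finite M_z M_z ..
  have db: "deriv b \<in> tests1 (-(1/2)) (1/2)" by (rule tests1_deriv[OF b])
  obtain K where K: "\<And>x. \<bar>deriv b x\<bar> \<le> K" using tests1_bounded[OF db] by blast
  have [measurable]: "g \<in> borel_measurable M_z" using g by simp
  have [measurable]: "deriv b \<in> borel_measurable borel" by (rule tests1_measurable[OF db])
  let ?F = "\<lambda>z s. (if s \<le> z then 1 else 0) * g s * deriv b z"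
  have ind: "indicator {..z} s = (if s \<le> z then 1 else (0::real))" for s z by simp
  have bd: "\<bar>?F z s\<bar> \<le> K * \<bar>g s\<bar>" for z s
    using K[of z] mult_mono[OF K[of z] order_refl[of "\<bar>g s\<bar>"]] by (auto simp: abs_mult mult.commute)
  have Fm: "(\<lambda>(z, s). ?F z s) \<in> borel_measurable (M_z \<Otimes>\<^sub>M M_z)" by measurable
  have Fi: "integrable M_z (\<lambda>s. ?F z s)" for z
  proof (rule Bochner_Integration.integrable_bound[of _ "\<lambda>s. K * \<bar>g s\<bar>"])
    show "AE s in M_z. norm (?F z s) \<le> norm (K * \<bar>g s\<bar>)"
      using order_trans[OF bd abs_ge_self] by (intro AE_I2) (simp only: real_norm_def)
  qed (use g in simp_all)
  have int: "integrable (M_z \<Otimes>\<^sub>M M_z) (\<lambda>(z, s). ?F z s)"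
  proof (rule zz.Fubini_integrable[OF Fm])
    show "integrable M_z (\<lambda>x. LINT y|M_z. norm ((\<lambda>(z, s). ?F z s) (x, y)))"
    proof (rule z.integrable_const_bound[where B = "LINT s|M_z. K * \<bar>g s\<bar>"])
      show "AE x in M_z. norm (LINT y|M_z. norm ((\<lambda>(z, s). ?F z s) (x, y))) \<le> (LINT s|M_z. K * \<bar>g s\<bar>)"
      proof (rule AE_I2)
        fix x
        have "(LINT y|M_z. norm (?F x y)) \<le> (LINT s|M_z. K * \<bar>g s\<bar>)"
          using Fi[of x] g bd by (intro integral_mono) (auto simp: integrable_norm)
        then show "norm (LINT y|M_z. norm ((\<lambda>(z, s). ?F z s) (x, y))) \<le> (LINT s|M_z. K * \<bar>g s\<bar>)"
          by (simp add: integral_nonneg_AE)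
      qed
    qed measurable
    show "AE x in M_z. integrable M_z (\<lambda>y. (\<lambda>(z, s). ?F z s) (x, y))" using Fi by simp
  qed
  have inner: "(LINT z|M_z. ?F z s) = - (g s * b s)" if "s \<in> space M_z" for s
  proof -
    have s: "-(1/2) \<le> s" "s \<le> 1/2" using that by (auto simp: space_restrict_space)
    have "(LINT z|M_z. ?F z s) = g s * (LINT z|M_z. (if s \<le> z then 1 else 0) * deriv b z)"
      by (subst integral_mult_right_zero[symmetric]) (simp add: ac_simps)
    also have "(LINT z|M_z. (if s \<le> z then 1 else 0) * deriv b z) = (LINT z|lborel. deriv b z * indicator {s..1/2} z)"
      using s by (subst integral_restrict_space) (auto intro!: Bochner_Integration.integral_cong simp: indicator_def)
    also have "\<dots> = b (1/2) - b s"
      using s smooth1_DERIV[OF tests1_smooth1[OF b]] smooth1_continuous[OF tests1_smooth1[OF db], of UNIV]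
      by (intro integral_FTC_Icc_real) (auto simp: continuous_on_eq_continuous_at)
    also have "b (1/2) = 0" using tests1_zero[OF b] by auto
    finally show ?thesis by simp
  qed
  have "(LINT z|M_z. (LINT s|M_z. indicator {..z} s * g s) * deriv b z) = (LINT z|M_z. LINT s|M_z. ?F z s)"
    by (simp add: ind)
  also have "\<dots> = (LINT s|M_z. LINT z|M_z. ?F z s)"
    by (rule zz.Fubini_integral[OF int, symmetric])
  also have "\<dots> = (LINT s|M_z. - (g s * b s))"
    by (rule Bochner_Integration.integral_cong[OF refl inner])
  finally show ?thesis by simp
qed

lemma primitive_z_test:
  assumes g: "integrable Omega_measure g"
    and a: "a \<in> tests1 0 (2 * pi)" and b: "b \<in> tests1 (-(1/2)) (1/2)"
  shows "(LINT x|Omega_measure. primitive_z g x * tensor a (deriv b) x)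
    = - (LINT x|Omega_measure. g x * tensor a b x)"
proof -
  have "(LINT x|Omega_measure. primitive_z g x * tensor a (deriv b) x)
      = (LINT \<theta>|M_theta. LINT z|M_z. primitive_z g (\<theta>, z) * tensor a (deriv b) (\<theta>, z))"
    by (rule integral_Omega_iterated[OF integrable_mult_tensor[OF primitive_z_integrable[OF g] a tests1_deriv[OF b]]])
  also have "\<dots> = (LINT \<theta>|M_theta. - (LINT z|M_z. g (\<theta>, z) * tensor a b (\<theta>, z)))"
  proof (rule integral_cong_AE)
    show "(\<lambda>\<theta>. LINT z|M_z. primitive_z g (\<theta>, z) * tensor a (deriv b) (\<theta>, z)) \<in> borel_measurable M_theta"
      using integrable_slice_integral[OF integrable_mult_tensor[OF primitive_z_integrable[OF g] a tests1_deriv[OF b]]] by simp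
    show "(\<lambda>\<theta>. - (LINT z|M_z. g (\<theta>, z) * tensor a b (\<theta>, z))) \<in> borel_measurable M_theta"
      using integrable_slice_integral[OF integrable_mult_tensor[OF g a b]] by simp
    show "AE \<theta> in M_theta. (LINT z|M_z. primitive_z g (\<theta>, z) * tensor a (deriv b) (\<theta>, z))
        = - (LINT z|M_z. g (\<theta>, z) * tensor a b (\<theta>, z))"
      using AE_slice_integrable[OF g]
    proof eventually_elim
      case (elim \<theta>)
      have "(LINT z|M_z. primitive_z g (\<theta>, z) * tensor a (deriv b) (\<theta>, z))
          = (LINT z|M_z. a \<theta> * ((LINT s|M_z. indicator {..z} s * g (\<theta>, s)) * deriv b z))"
        by (simp add: primitive_z_def tensor_def mult.left_commute)
      also have "\<dots> = a \<theta> * - (LINT s|M_z. g (\<theta>, s) * b s)"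
        by (simp only: integral_mult_right_zero integration_by_parts_slice[OF elim b])
      also have "\<dots> = - (LINT z|M_z. a \<theta> * (g (\<theta>, z) * b z))" by simp
      also have "\<dots> = - (LINT z|M_z. g (\<theta>, z) * tensor a b (\<theta>, z))"
        by (simp add: tensor_def mult.left_commute)
      finally show ?case .
    qed
  qed
  also have "\<dots> = - (LINT x|Omega_measure. g x * tensor a b x)"
    by (simp add: integral_Omega_iterated[OF integrable_mult_tensor[OF g a b]])
  finally show ?thesis .
qed

text \<open>
  Fix a test \<open>b0\<close> with nonzero integral. Every test \<open>b\<close> differs from a multiple of \<open>b0\<close> by a test of
  zero integral, that is, by the derivative of a test. Hence pairing \<open>r\<close> with \<open>b\<close> along slices only
  sees the integral of \<open>b\<close>, and the weighted average of \<open>r\<close> against \<open>b0\<close> serves as the constant.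
\<close>

lemma weakly_constant_in_z:
  assumes r: "integrable Omega_measure r"
    and test: "\<And>a b. a \<in> tests1 0 (2 * pi) \<Longrightarrow> b \<in> tests1 (-(1/2)) (1/2) \<Longrightarrow>
      (LINT x|Omega_measure. r x * tensor a (deriv b) x) = 0"
  shows "\<exists>c. AE x in Omega_measure. r x = c (fst x)"
proof -
  obtain b0 where b0: "b0 \<in> tests1 (-(1/2)) (1/2)" and I0: "(LINT z|M_z. b0 z) \<noteq> 0"
    using ex_tests1_integral_nonzero by blast
  define I where "I = (LINT z|M_z. b0 z)"
  obtain K where K: "\<And>x. \<bar>b0 x\<bar> \<le> K" using tests1_bounded[OF b0] by blast
  have b0m [measurable]: "b0 \<in> borel_measurable borel" by (rule tests1_measurable[OF b0])
  have rb: "integrable Omega_measure (\<lambda>x. r x * b0 (snd x))"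
  proof (rule Bochner_Integration.integrable_bound[of _ "\<lambda>x. K * r x"])
    show "integrable Omega_measure (\<lambda>x. K * r x)" using r by simp
    have "(\<lambda>x. b0 (snd x)) \<in> borel_measurable Omega_measure"
      unfolding Omega_measure_eq by measurable
    then show "(\<lambda>x. r x * b0 (snd x)) \<in> borel_measurable Omega_measure"
      using r by (intro borel_measurable_times) simp_all
    have "\<bar>b0 y\<bar> \<le> \<bar>K\<bar>" for y using K[of y] by linarith
    then show "AE x in Omega_measure. norm (r x * b0 (snd x)) \<le> norm (K * r x)"
      by (intro AE_I2) (simp add: abs_mult mult.commute[of "\<bar>r _\<bar>"] mult_right_mono)
  qed
  define c where "c \<theta> = (LINT z|M_z. r (\<theta>, z) * b0 z) / I" for \<theta>
  have ci: "integrable M_theta c"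
    unfolding c_def[abs_def] using integrable_slice_integral[OF rb] by simp
  have cfi: "integrable Omega_measure (\<lambda>x. c (fst x))" by (rule integrable_comp_fst[OF ci])
  have "AE x in Omega_measure. r x - c (fst x) = 0"
  proof (rule fundamental_lemma)
    show "integrable Omega_measure (\<lambda>x. r x - c (fst x))" using r cfi by simp
    fix a b assume a: "a \<in> tests1 0 (2 * pi)" and b: "b \<in> tests1 (-(1/2)) (1/2)"
    \<comment> \<open>The multiple of \<open>b0\<close> that has the same integral as \<open>b\<close>.\<close>
    define \<kappa> where "\<kappa> = (LINT z|M_z. b z) / I"
    let ?b = "\<lambda>z. b z + (- \<kappa>) * b0 z"
    have bt: "?b \<in> tests1 (-(1/2)) (1/2)" by (rule tests1_lincomb[OF b b0])
    have bi: "integrable M_z b'" if "b' \<in> tests1 (-(1/2)) (1/2)" for b'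
    proof -
      have "set_integrable lborel {-(1/2)..1/2} b'"
        using that by (intro borel_integrable_atLeastAtMost' smooth1_continuous tests1_smooth1)
      then show ?thesis by (subst integrable_restrict_space) (simp_all add: set_integrable_def)
    qed
    have "(LINT z|M_z. ?b z) = (LINT z|M_z. b z) - \<kappa> * I"
      using bi[OF b] bi[OF b0] by (simp add: I_def)
    also have "\<dots> = 0" using I0 by (simp add: \<kappa>_def I_def)
    finally have "integral {-(1/2)..1/2} ?b = 0" unfolding tests1_integral_Icc[OF bt] .
    then obtain B where B: "B \<in> tests1 (-(1/2)) (1/2)" "deriv B = ?b"
      using tests1_antideriv[OF bt] by auto
    have "(LINT x|Omega_measure. r x * tensor a ?b x) = 0"
      using test[OF a B(1)] B(2) by simp
    moreover have "r x * tensor a ?b x = r x * tensor a b x - \<kappa> * (r x * tensor a b0 x)" for x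
      by (cases x) (simp add: tensor_def algebra_simps)
    ultimately have eq: "(LINT x|Omega_measure. r x * tensor a b x) = \<kappa> * (LINT x|Omega_measure. r x * tensor a b0 x)"
      using integrable_mult_tensor[OF r a b] integrable_mult_tensor[OF r a b0] by simp
    have "(LINT x|Omega_measure. c (fst x) * tensor a b x) = (LINT \<theta>|M_theta. LINT z|M_z. (c \<theta> * a \<theta>) * b z)"
      unfolding integral_Omega_iterated[OF integrable_mult_tensor[OF cfi a b]] by (simp add: tensor_def mult.assoc)
    also have "\<dots> = (LINT \<theta>|M_theta. c \<theta> * a \<theta>) * (LINT z|M_z. b z)" by simp
    also have "(LINT \<theta>|M_theta. c \<theta> * a \<theta>) = (LINT \<theta>|M_theta. (1 / I) * (LINT z|M_z. r (\<theta>, z) * tensor a b0 (\<theta>, z)))"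
    proof (rule Bochner_Integration.integral_cong[OF refl])
      fix \<theta>
      have "(LINT z|M_z. r (\<theta>, z) * tensor a b0 (\<theta>, z)) = (LINT z|M_z. a \<theta> * (r (\<theta>, z) * b0 z))"
        by (simp add: tensor_def mult.left_commute)
      also have "\<dots> = a \<theta> * (LINT z|M_z. r (\<theta>, z) * b0 z)" by simp
      finally show "c \<theta> * a \<theta> = (1 / I) * (LINT z|M_z. r (\<theta>, z) * tensor a b0 (\<theta>, z))"
        by (simp add: c_def)
    qed
    also have "\<dots> = (1 / I) * (LINT x|Omega_measure. r x * tensor a b0 x)"
      by (simp add: integral_Omega_iterated[OF integrable_mult_tensor[OF r a b0]])
    finally have "(LINT x|Omega_measure. c (fst x) * tensor a b x) = \<kappa> * (LINT x|Omega_measure. r x * tensor a b0 x)"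
      by (simp add: \<kappa>_def)
    then show "(LINT x|Omega_measure. (r x - c (fst x)) * tensor a b x) = 0"
      using eq integrable_mult_tensor[OF r a b] integrable_mult_tensor[OF cfi a b]
      by (simp add: left_diff_distrib)
  qed
  then have "AE x in Omega_measure. r x = c (fst x)" by eventually_elim simp
  then show ?thesis by blast
qed

text \<open>
  The difference between \<open>f\<close> and the primitive of \<open>g\<close> has vanishing weak axial derivative.
\<close>

lemma slice_representation:
  assumes f: "f \<in> L2" and g: "g \<in> L2"
    and test: "\<And>a b. a \<in> tests1 0 (2 * pi) \<Longrightarrow> b \<in> tests1 (-(1/2)) (1/2) \<Longrightarrow>
      (LINT x|Omega_measure. f x * tensor a (deriv b) x) = - (LINT x|Omega_measure. g x * tensor a b x)"
  shows "AE \<theta> in M_theta. \<exists>c. AE z in M_z. f (\<theta>, z) = c + (LINT s|M_z. indicator {..z} s * g (\<theta>, s))"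
proof -
  note gi = L2_integrable[OF g] and fi = L2_integrable[OF f]
  note Vi = primitive_z_integrable[OF gi]
  have "\<exists>c. AE x in Omega_measure. f x - primitive_z g x = c (fst x)"
  proof (rule weakly_constant_in_z)
    show "integrable Omega_measure (\<lambda>x. f x - primitive_z g x)" using fi Vi by simp
    fix a b assume a: "a \<in> tests1 0 (2 * pi)" and b: "b \<in> tests1 (-(1/2)) (1/2)"
    show "(LINT x|Omega_measure. (f x - primitive_z g x) * tensor a (deriv b) x) = 0"
      using test[OF a b] primitive_z_test[OF gi a b]
        integrable_mult_tensor[OF fi a tests1_deriv[OF b]] integrable_mult_tensor[OF Vi a tests1_deriv[OF b]]
      by (simp add: left_diff_distrib)
  qed
  then obtain c where "AE x in Omega_measure. f x - primitive_z g x = c (fst x)" by blast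
  from AE_slices[OF this] show ?thesis
  proof eventually_elim
    case (elim \<theta>)
    then have "AE z in M_z. f (\<theta>, z) = c \<theta> + (LINT s|M_z. indicator {..z} s * g (\<theta>, s))"
      by eventually_elim (simp add: primitive_z_def)
    then show ?case by blast
  qed
qed

text \<open>
  Test with functions of the angle alone, whose axial derivative is zero.
\<close>

lemma periodic_z_deriv_mean_zero:
  assumes q: "q \<in> L2" and w: "has_weak_deriv per_tests 0 1 f q"
  shows "AE \<theta> in M_theta. (LINT z|M_z. q (\<theta>, z)) = 0"
proof -
  interpret z: prob_space M_z by (rule prob_space_M_z)
  define Q where "Q \<theta> = (LINT z|M_z. q (\<theta>, z))" for \<theta>
  have qi: "integrable Omega_measure q" by (rule L2_integrable[OF q])
  have Qi: "integrable Omega_measure (\<lambda>x. Q (fst x))"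
    unfolding Q_def by (rule integrable_comp_fst[OF integrable_slice_integral[OF qi]])
  have "AE x in Omega_measure. Q (fst x) = 0"
  proof (rule fundamental_lemma[OF Qi])
    fix a b assume a: "a \<in> tests1 0 (2 * pi)" and b: "b \<in> tests1 (-(1/2)) (1/2)"
    let ?\<psi> = "\<lambda>(\<theta>, z::real). a (wrap (2 * pi) \<theta>)"
    have P: "?\<psi> \<in> per_tests" by (rule theta_test_per_tests[OF a])
    have "pd 0 1 ?\<psi> = (\<lambda>x. 0)" by (auto simp: pd_def pd_z_def)
    then have 0: "(LINT x|Omega_measure. q x * ?\<psi> x) = 0"
      using w P unfolding has_weak_deriv_def by fastforce
    have psi: "?\<psi> \<in> L2" using P by (auto simp: per_tests_def intro: smooth_L2)
    have "(LINT x|Omega_measure. q x * ?\<psi> x) = (LINT \<theta>|M_theta. LINT z|M_z. q (\<theta>, z) * a (wrap (2 * pi) \<theta>))"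
      by (simp add: integral_Omega_iterated[OF L2_mult_integrable[OF q psi]])
    also have "\<dots> = (LINT \<theta>|M_theta. Q \<theta> * a \<theta>)"
    proof (rule Bochner_Integration.integral_cong[OF refl])
      fix \<theta> assume "\<theta> \<in> space M_theta"
      then have t: "0 \<le> \<theta>" "\<theta> \<le> 2 * pi" by (auto simp: space_restrict_space)
      \<comment> \<open>At the right end \<open>wrap\<close> jumps back to \<open>0\<close>, but \<open>a\<close> vanishes at both ends.\<close>
      have "a (wrap (2 * pi) \<theta>) = a \<theta>"
      proof (cases "\<theta> = 2 * pi")
        case True
        then show ?thesis using tests1_zero[OF a, of 0] tests1_zero[OF a, of "2 * pi"] by (simp add: wrap_def)
      next
        case False
        then show ?thesis using t by (simp add: wrap_id)
      qed
      then show "(LINT z|M_z. q (\<theta>, z) * a (wrap (2 * pi) \<theta>)) = Q \<theta> * a \<theta>" by (simp add: Q_def)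
    qed
    finally have QA: "(LINT \<theta>|M_theta. Q \<theta> * a \<theta>) = 0" using 0 by simp
    have "(LINT x|Omega_measure. Q (fst x) * tensor a b x) = (LINT \<theta>|M_theta. LINT z|M_z. (Q \<theta> * a \<theta>) * b z)"
      unfolding integral_Omega_iterated[OF integrable_mult_tensor[OF Qi a b]] by (simp add: tensor_def mult.assoc)
    also have "\<dots> = (LINT \<theta>|M_theta. Q \<theta> * a \<theta>) * (LINT z|M_z. b z)" by simp
    finally show "(LINT x|Omega_measure. Q (fst x) * tensor a b x) = 0" using QA by simp
  qed
  from AE_slices[OF this] show ?thesis by eventually_elim (simp add: Q_def)
qed

section \<open>Interpolation for nonnegative functions on a slice\<close>

lemma integrable_M_z_indicator:
  fixes g :: "real \<Rightarrow> real"
  assumes "integrable M_z g" "A \<in> sets borel"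
  shows "integrable M_z (\<lambda>s. indicator A s * g s)"
proof (rule Bochner_Integration.integrable_bound[OF assms(1)])
  have "(indicator A :: real \<Rightarrow> real) \<in> borel_measurable M_z"
    using assms(2) by (intro measurable_restrict_space1) simp
  then show "(\<lambda>s. indicator A s * g s) \<in> borel_measurable M_z"
    using assms(1) by (intro borel_measurable_times) simp_all
qed (auto simp: indicator_def)

lemma integral_M_z_const_interval:
  assumes "-(1/2) \<le> s" "s \<le> t" "t \<le> 1/2"
  shows "(LINT z|M_z. indicator {s..<t} z * c) = (t - s) * c"
    and "(LINT z|M_z. indicator {s<..t} z * c) = (t - s) * c"
proof -
  have *: "(LINT z|M_z. indicator A z * c) = (LINT z|lborel. indicator A z) * c"
    if "A \<subseteq> {-(1/2)..1/2}" for A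
  proof -
    have "(LINT z|M_z. indicator A z) = (LINT z|lborel. indicator {-(1/2)..1/2} z *\<^sub>R indicator A z :: real)"
      by (rule integral_restrict_space) simp
    also have "\<dots> = (LINT z|lborel. indicator A z)"
      using that by (intro Bochner_Integration.integral_cong) (auto simp: indicator_def)
    finally show ?thesis by simp
  qed
  show "(LINT z|M_z. indicator {s..<t} z * c) = (t - s) * c"
    using assms by (subst *) auto
  show "(LINT z|M_z. indicator {s<..t} z * c) = (t - s) * c"
    using assms by (subst *) auto
qed

lemma primitive_increment:
  fixes g :: "real \<Rightarrow> real"
  assumes g: "integrable M_z g" and "z \<le> z'"
  shows "(LINT s|M_z. indicator {..z'} s * g s) - (LINT s|M_z. indicator {..z} s * g s)
    = (LINT s|M_z. indicator {z<..z'} s * g s)"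
proof -
  have "(LINT s|M_z. indicator {..z'} s * g s) - (LINT s|M_z. indicator {..z} s * g s)
    = (LINT s|M_z. indicator {..z'} s * g s - indicator {..z} s * g s)"
    using integrable_M_z_indicator[OF g] by simp
  also have "\<dots> = (LINT s|M_z. indicator {z<..z'} s * g s)"
    using assms(2) by (intro Bochner_Integration.integral_cong) (auto simp: indicator_def)
  finally show ?thesis .
qed

lemma lower_bound_on_subinterval:
  assumes u: "integrable M_z u" and nonneg: "AE z in M_z. 0 \<le> u z"
    and sub: "s \<le> s'" "s' \<le> t'" "t' \<le> t" "-(1/2) \<le> s" "t \<le> 1/2"
    and low: "AE z in M_z. z \<in> {s'..<t'} \<longrightarrow> k \<le> u z"
  shows "k * (t' - s') \<le> (LINT z|M_z. indicator {s..<t} z * u z)"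
proof -
  interpret z: prob_space M_z by (rule prob_space_M_z)
  have "(t' - s') * k = (LINT z|M_z. indicator {s'..<t'} z * k)"
    by (rule integral_M_z_const_interval(1)[symmetric]) (use sub in auto)
  also have "\<dots> \<le> (LINT z|M_z. indicator {s..<t} z * u z)"
  proof (rule integral_mono_AE)
    show "integrable M_z (\<lambda>z. indicator {s'..<t'} z * k)"
      by (rule integrable_M_z_indicator) simp_all
    show "integrable M_z (\<lambda>z. indicator {s..<t} z * u z)"
      by (rule integrable_M_z_indicator[OF u]) simp
    show "AE z in M_z. indicator {s'..<t'} z * k \<le> indicator {s..<t} z * u z"
      using nonneg low by eventually_elim (use sub in \<open>auto simp: indicator_def\<close>)
  qed
  finally show ?thesis by (simp add: mult.commute)
qed

text \<open>
  If \<open>\<sigma> * v \<ge> m > 0\<close> on a cell of length \<open>l\<close>, then \<open>u\<close> changes by at least \<open>m * l / 3\<close> between any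
  point of the first third and any point of the last third. As \<open>u\<close> is nonnegative, it is at least
  \<open>m * l / 6\<close> throughout one of these thirds, which bounds its integral below by
  \<open>m * l\<^sup>2 / 18\<close>. The sign \<open>\<sigma>\<close> treats increasing and decreasing \<open>u\<close> at once.
\<close>

lemma slope_bound_nonneg:
  assumes u: "integrable M_z u" and v: "integrable M_z v"
    and nonneg: "AE z in M_z. 0 \<le> u z"
    and rep: "AE z in M_z. u z = c + (LINT s|M_z. indicator {..z} s * v s)"
    and J: "-(1/2) \<le> s" "0 < l" "s + l \<le> 1/2"
    and \<sigma>: "\<bar>\<sigma>\<bar> = 1" and slope: "AE z in M_z. z \<in> {s..<s + l} \<longrightarrow> m \<le> \<sigma> * v z"
  shows "m \<le> 18 / l\<^sup>2 * (LINT z|M_z. indicator {s..<s + l} z * u z)"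
proof (cases "m \<le> 0")
  case True
  have "0 \<le> (LINT z|M_z. indicator {s..<s + l} z * u z)"
    by (rule integral_nonneg_AE) (use nonneg in eventually_elim, auto simp: indicator_def)
  then have "0 \<le> 18 / l\<^sup>2 * (LINT z|M_z. indicator {s..<s + l} z * u z)" by simp
  then show ?thesis using True by linarith
next
  case False
  define G where "G z \<longleftrightarrow> 0 \<le> u z \<and> u z = c + (LINT s|M_z. indicator {..z} s * v s)" for z
  have G: "AE z in M_z. G z" using nonneg rep by eventually_elim (simp add: G_def)
  have incr: "m * (z' - z) \<le> u z + u z'"
    if z: "G z" "G z'" "s \<le> z" "z \<le> z'" "z' < s + l" for z z'
  proof -
    have "(z' - z) * m = (LINT s|M_z. indicator {z<..z'} s * m)"
      by (rule integral_M_z_const_interval(2)[symmetric]) (use z J in auto)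
    also have "\<dots> \<le> (LINT s|M_z. indicator {z<..z'} s * (\<sigma> * v s))"
    proof (rule integral_mono_AE)
      interpret z: prob_space M_z by (rule prob_space_M_z)
      show "integrable M_z (\<lambda>s. indicator {z<..z'} s * m)" by (rule integrable_M_z_indicator) simp_all
      show "integrable M_z (\<lambda>s. indicator {z<..z'} s * (\<sigma> * v s))"
        by (rule integrable_M_z_indicator) (use v in simp_all)
      show "AE s in M_z. indicator {z<..z'} s * m \<le> indicator {z<..z'} s * (\<sigma> * v s)"
        using slope by eventually_elim (use z in \<open>auto simp: indicator_def\<close>)
    qed
    also have "\<dots> = \<sigma> * (LINT s|M_z. indicator {z<..z'} s * v s)"
      by (simp add: mult.left_commute)
    also have "\<dots> = \<sigma> * (u z' - u z)"
      using z primitive_increment[OF v z(4)] by (simp add: G_def)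
    also have "\<dots> \<le> \<bar>u z' - u z\<bar>"
      using \<sigma> abs_ge_self[of "\<sigma> * (u z' - u z)"] by (simp add: abs_mult)
    also have "\<dots> \<le> u z + u z'" using z by (auto simp: G_def)
    finally show ?thesis by (simp add: mult.commute)
  qed
  have "m * l / 6 * (l / 3) \<le> (LINT z|M_z. indicator {s..<s + l} z * u z)"
  proof (cases "\<exists>z\<in>{s..<s + l/3}. G z \<and> u z \<le> m * l / 6")
    case True
    then obtain z where z: "s \<le> z" "z < s + l / 3" "G z" "u z \<le> m * l / 6" by auto
    have "AE z' in M_z. z' \<in> {s + 2 * l / 3..<s + l} \<longrightarrow> m * l / 6 \<le> u z'"
      using G
    proof eventually_elim
      case (elim z')
      show ?case
      proof
        assume z': "z' \<in> {s + 2 * l / 3..<s + l}"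
        have "m * (l / 3) \<le> m * (z' - z)" using z z' False by (intro mult_left_mono) auto
        also have "\<dots> \<le> u z + u z'" using z z' elim by (intro incr) auto
        finally show "m * l / 6 \<le> u z'" using z(4) by simp
      qed
    qed
    then have "m * l / 6 * (s + l - (s + 2 * l / 3)) \<le> (LINT z|M_z. indicator {s..<s + l} z * u z)"
      by (intro lower_bound_on_subinterval[OF u nonneg]) (use J in auto)
    then show ?thesis by (simp add: field_simps)
  next
    case f: False
    have "AE z in M_z. z \<in> {s..<s + l / 3} \<longrightarrow> m * l / 6 \<le> u z"
      using G by eventually_elim (use f in force)
    then have "m * l / 6 * (s + l / 3 - s) \<le> (LINT z|M_z. indicator {s..<s + l} z * u z)"
      by (intro lower_bound_on_subinterval[OF u nonneg]) (use J in auto)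
    then show ?thesis by (simp add: field_simps)
  qed
  then show ?thesis using J by (simp add: field_simps power2_eq_square)
qed

text \<open>
  Within the cell \<open>v\<close> oscillates by at most the integral of \<open>\<bar>w\<bar>\<close>. So if \<open>v\<close> is larger than this at
  one point, it keeps its sign and is bounded below on the whole cell, and the bound on slopes of
  nonnegative functions applies.
\<close>

lemma cell_sup_bound:
  assumes u: "integrable M_z u" and v: "integrable M_z v" and w: "integrable M_z w"
    and nonneg: "AE z in M_z. 0 \<le> u z"
    and rep_u: "AE z in M_z. u z = c + (LINT s|M_z. indicator {..z} s * v s)"
    and rep_v: "AE z in M_z. v z = d + (LINT s|M_z. indicator {..z} s * w s)"
    and J: "-(1/2) \<le> s" "0 < l" "s + l \<le> 1/2"
  shows "AE y in M_z. y \<in> {s..<s + l} \<longrightarrow> \<bar>v y\<bar> \<le>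
    (LINT z|M_z. indicator {s..<s + l} z * \<bar>w z\<bar>) + 18 / l\<^sup>2 * (LINT z|M_z. indicator {s..<s + l} z * u z)"
    (is "AE y in M_z. _ \<longrightarrow> _ \<le> ?\<omega> + _")
proof -
  have osc: "\<bar>v z' - v z\<bar> \<le> ?\<omega>"
    if z: "v z = d + (LINT s|M_z. indicator {..z} s * w s)" "v z' = d + (LINT s|M_z. indicator {..z'} s * w s)"
      "s \<le> z" "z \<le> z'" "z' < s + l" for z z'
  proof -
    have "\<bar>v z' - v z\<bar> = \<bar>LINT t|M_z. indicator {z<..z'} t * w t\<bar>"
      using z primitive_increment[OF w z(4)] by simp
    also have "\<dots> \<le> (LINT t|M_z. \<bar>indicator {z<..z'} t * w t\<bar>)" by (rule integral_abs_bound)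
    also have "\<dots> \<le> ?\<omega>"
    proof (rule integral_mono)
      show "integrable M_z (\<lambda>t. \<bar>indicator {z<..z'} t * w t\<bar>)"
        by (intro integrable_abs integrable_M_z_indicator w) simp
      show "integrable M_z (\<lambda>t. indicator {s..<s + l} t * \<bar>w t\<bar>)"
        by (intro integrable_M_z_indicator integrable_abs w) simp
    qed (use z in \<open>auto simp: indicator_def\<close>)
    finally show ?thesis .
  qed
  show ?thesis
    using rep_v
  proof eventually_elim
    case y: (elim y)
    show ?case
    proof
      assume yJ: "y \<in> {s..<s + l}"
      define \<sigma> :: real where "\<sigma> = (if v y \<ge> 0 then 1 else -1)"
      have "AE z in M_z. z \<in> {s..<s + l} \<longrightarrow> \<bar>v y\<bar> - ?\<omega> \<le> \<sigma> * v z"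
        using rep_v
      proof eventually_elim
        case (elim z)
        show ?case
        proof
          assume "z \<in> {s..<s + l}"
          then have "\<bar>v z - v y\<bar> \<le> ?\<omega>"
            using osc[of y z] osc[of z y] y elim yJ by (cases "y \<le> z") (auto simp: abs_minus_commute)
          then show "\<bar>v y\<bar> - ?\<omega> \<le> \<sigma> * v z" by (auto simp: \<sigma>_def split: if_splits)
        qed
      qed
      then have "\<bar>v y\<bar> - ?\<omega> \<le> 18 / l\<^sup>2 * (LINT z|M_z. indicator {s..<s + l} z * u z)"
        by (intro slope_bound_nonneg[OF u v nonneg rep_u J, of \<sigma>]) (auto simp: \<sigma>_def)
      then show "\<bar>v y\<bar> \<le> ?\<omega> + 18 / l\<^sup>2 * (LINT z|M_z. indicator {s..<s + l} z * u z)" by simp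
    qed
  qed
qed

text \<open>
  Expand the integral of the square of \<open>\<bar>w\<bar> - \<omega> / l\<close>, where \<open>\<omega>\<close> is the integral on the left.
\<close>

lemma cell_cauchy_schwarz:
  assumes w: "integrable M_z w" and w2: "integrable M_z (\<lambda>z. (w z)\<^sup>2)"
    and J: "-(1/2) \<le> s" "0 < l" "s + l \<le> 1/2"
  shows "(LINT z|M_z. indicator {s..<s + l} z * \<bar>w z\<bar>)\<^sup>2 \<le> l * (LINT z|M_z. indicator {s..<s + l} z * (w z)\<^sup>2)"
proof -
  interpret z: prob_space M_z by (rule prob_space_M_z)
  let ?J = "indicator {s..<s + l} :: real \<Rightarrow> real"
  define \<omega> where "\<omega> = (LINT z|M_z. ?J z * \<bar>w z\<bar>)"
  have i: "integrable M_z (\<lambda>z. ?J z * (w z)\<^sup>2)" "integrable M_z (\<lambda>z. ?J z * \<bar>w z\<bar>)"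
    "integrable M_z (\<lambda>z. ?J z * (\<omega> / l)\<^sup>2)"
    by (intro integrable_M_z_indicator w2 integrable_abs w z.integrable_const; simp)+
  have "0 \<le> (LINT z|M_z. ?J z * (\<bar>w z\<bar> - \<omega> / l)\<^sup>2)" by (rule integral_nonneg_AE) simp
  also have "\<dots> = (LINT z|M_z. ?J z * (w z)\<^sup>2 - 2 * \<omega> / l * (?J z * \<bar>w z\<bar>) + ?J z * (\<omega> / l)\<^sup>2)"
    by (intro Bochner_Integration.integral_cong) (auto simp: power2_diff algebra_simps)
  also have "\<dots> = (LINT z|M_z. ?J z * (w z)\<^sup>2) - 2 * \<omega> / l * \<omega> + (LINT z|M_z. ?J z * (\<omega> / l)\<^sup>2)"
    using i by (simp add: \<omega>_def)
  also have "(LINT z|M_z. ?J z * (\<omega> / l)\<^sup>2) = l * (\<omega> / l)\<^sup>2"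
    using integral_M_z_const_interval(1)[of s "s + l" "(\<omega> / l)\<^sup>2"] J by simp
  finally show ?thesis using J unfolding \<omega>_def[symmetric] by (simp add: field_simps power2_eq_square)
qed

lemma cell_energy_bound:
  assumes u: "integrable M_z u" and v: "integrable M_z v" and w: "integrable M_z w"
    and v2: "integrable M_z (\<lambda>z. (v z)\<^sup>2)" and w2: "integrable M_z (\<lambda>z. (w z)\<^sup>2)"
    and nonneg: "AE z in M_z. 0 \<le> u z"
    and rep_u: "AE z in M_z. u z = c + (LINT s|M_z. indicator {..z} s * v s)"
    and rep_v: "AE z in M_z. v z = d + (LINT s|M_z. indicator {..z} s * w s)"
    and J: "-(1/2) \<le> s" "0 < l" "s + l \<le> 1/2"
  shows "(LINT z|M_z. indicator {s..<s + l} z * (v z)\<^sup>2) \<le>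
    2 * l\<^sup>2 * (LINT z|M_z. indicator {s..<s + l} z * (w z)\<^sup>2)
    + 648 / l ^ 3 * (LINT z|M_z. indicator {s..<s + l} z * u z)\<^sup>2"
proof -
  interpret z: prob_space M_z by (rule prob_space_M_z)
  let ?J = "indicator {s..<s + l} :: real \<Rightarrow> real"
  define \<omega> where "\<omega> = (LINT z|M_z. ?J z * \<bar>w z\<bar>)"
  define \<alpha> where "\<alpha> = (LINT z|M_z. ?J z * u z)"
  define K where "K = 2 * \<omega>\<^sup>2 + 2 * (18 / l\<^sup>2 * \<alpha>)\<^sup>2"
  have "(LINT z|M_z. ?J z * (v z)\<^sup>2) \<le> (LINT z|M_z. ?J z * K)"
  proof (rule integral_mono_AE)
    show "integrable M_z (\<lambda>z. ?J z * (v z)\<^sup>2)" "integrable M_z (\<lambda>z. ?J z * K)"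
      by (intro integrable_M_z_indicator v2 z.integrable_const; simp)+
    show "AE z in M_z. ?J z * (v z)\<^sup>2 \<le> ?J z * K"
      using cell_sup_bound[OF u v w nonneg rep_u rep_v J]
    proof eventually_elim
      case (elim z)
      show ?case
      proof (cases "z \<in> {s..<s + l}")
        case True
        then have "\<bar>v z\<bar> \<le> \<omega> + 18 / l\<^sup>2 * \<alpha>" using elim by (simp add: \<omega>_def \<alpha>_def)
        then have "(v z)\<^sup>2 \<le> (\<omega> + 18 / l\<^sup>2 * \<alpha>)\<^sup>2"
          using power_mono[of "\<bar>v z\<bar>" "\<omega> + 18 / l\<^sup>2 * \<alpha>" 2] by simp
        also have "\<dots> \<le> K"
          unfolding K_def using sum_squares_bound[of \<omega> "18 / l\<^sup>2 * \<alpha>"] by (simp add: power2_sum)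
        finally show ?thesis using True by simp
      qed simp
    qed
  qed
  also have "\<dots> = l * K" using integral_M_z_const_interval(1)[of s "s + l" K] J by simp
  also have "\<dots> = 2 * l * \<omega>\<^sup>2 + 648 / l ^ 3 * \<alpha>\<^sup>2"
    using J by (simp add: K_def field_simps power2_eq_square power3_eq_cube)
  also have "\<dots> \<le> 2 * l * (l * (LINT z|M_z. ?J z * (w z)\<^sup>2)) + 648 / l ^ 3 * \<alpha>\<^sup>2"
    using cell_cauchy_schwarz[OF w w2 J] J by (intro add_right_mono mult_left_mono) (auto simp: \<omega>_def)
  finally show ?thesis by (simp add: \<alpha>_def power2_eq_square mult.assoc)
qed

text \<open>
  The indicators of the cells telescope; only the upper end point is missed.
\<close>

lemma sum_over_cells:
  fixes g :: "real \<Rightarrow> real" and n :: nat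
  assumes g: "integrable M_z g" and n: "n > 0"
  shows "(\<Sum>k<n. LINT z|M_z. indicator {-(1/2) + real k / real n..<-(1/2) + real k / real n + 1 / real n} z * g z) = (LINT z|M_z. g z)"
proof -
  have "(\<Sum>k<n. LINT z|M_z. indicator {-(1/2) + real k / real n..<-(1/2) + real k / real n + 1 / real n} z * g z)
    = (LINT z|M_z. (\<Sum>k<n. indicator {-(1/2) + real k / real n..<-(1/2) + real k / real n + 1 / real n} z * g z))"
    by (rule Bochner_Integration.integral_sum[symmetric]) (rule integrable_M_z_indicator[OF g], simp)
  also have "\<dots> = (LINT z|M_z. g z)"
  proof (rule integral_cong_AE)
    show "(\<lambda>z. \<Sum>k<n. indicator {-(1/2) + real k / real n..<-(1/2) + real k / real n + 1 / real n} z * g z) \<in> borel_measurable M_z"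
      by (intro borel_measurable_sum borel_measurable_integrable integrable_M_z_indicator[OF g]) simp
    show "g \<in> borel_measurable M_z" using g by simp
    have "AE z in lborel. z \<noteq> (1/2::real)" by (rule AE_lborel_singleton)
    then have "AE z in M_z. z \<in> {-(1/2)..<1/2}"
      by (subst AE_restrict_space_iff) (auto elim: eventually_mono)
    then show "AE z in M_z. (\<Sum>k<n. indicator {-(1/2) + real k / real n..<-(1/2) + real k / real n + 1 / real n} z * g z) = g z"
    proof eventually_elim
      case (elim z)
      define F where "F k = (indicator {..<-(1/2) + real k / real n} z :: real)" for k
      have "indicator {-(1/2) + real k / real n..<-(1/2) + real k / real n + 1 / real n} z = F (Suc k) - F k" for k
        using n by (auto simp: F_def indicator_def field_simps)
      then have "(\<Sum>k<n. indicator {-(1/2) + real k / real n..<-(1/2) + real k / real n + 1 / real n} z * g z)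
          = (\<Sum>k<n. F (Suc k) - F k) * g z"
        by (simp add: sum_distrib_right)
      also have "(\<Sum>k<n. F (Suc k) - F k) = F n - F 0" by (rule sum_lessThan_telescope)
      also have "\<dots> = 1" using elim n by (auto simp: F_def)
      finally show ?case by simp
    qed
  qed
  finally show ?thesis .
qed

text \<open>
  The estimates on the cells are added up; the squares of the cell integrals of \<open>u\<close> add up to at most the
  square of their sum because these integrals are nonnegative. Optimizing over \<open>n\<close> would give the
  multiplicative inequality bounding the \<open>L\<^sup>2\<close> norm of \<open>u'\<close> by the powers \<open>2/5\<close> of the
  \<open>L\<^sup>1\<close> norm of \<open>u\<close> and \<open>3/5\<close> of the \<open>L\<^sup>2\<close> norm of \<open>u''\<close>, up to lower order terms; the free
  parameter is more convenient for integration over the slices.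
\<close>

lemma slice_interpolation:
  assumes u: "integrable M_z u" and v: "integrable M_z v" and w: "integrable M_z w"
    and v2: "integrable M_z (\<lambda>z. (v z)\<^sup>2)" and w2: "integrable M_z (\<lambda>z. (w z)\<^sup>2)"
    and nonneg: "AE z in M_z. 0 \<le> u z"
    and rep_u: "AE z in M_z. u z = c + (LINT s|M_z. indicator {..z} s * v s)"
    and rep_v: "AE z in M_z. v z = d + (LINT s|M_z. indicator {..z} s * w s)"
    and n: "n > 0"
  shows "(LINT z|M_z. (v z)\<^sup>2) \<le> 2 / (real n)\<^sup>2 * (LINT z|M_z. (w z)\<^sup>2) + 648 * real n ^ 3 * (LINT z|M_z. u z)\<^sup>2"
proof -
  let ?J = "\<lambda>k. indicator {-(1/2) + real k / real n..<-(1/2) + real k / real n + 1 / real n} :: real \<Rightarrow> real"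
  define \<alpha> where "\<alpha> k = (LINT z|M_z. ?J k z * u z)" for k
  have a0: "0 \<le> \<alpha> k" for k
    unfolding \<alpha>_def by (rule integral_nonneg_AE) (use nonneg in eventually_elim, auto simp: indicator_def)
  have "(\<Sum>k<n. (\<alpha> k)\<^sup>2) \<le> (\<Sum>k<n. (\<Sum>k<n. \<alpha> k) * \<alpha> k)"
  proof (rule sum_mono)
    fix k assume "k \<in> {..<n}"
    then have "\<alpha> k \<le> (\<Sum>k<n. \<alpha> k)" using a0 by (intro member_le_sum) auto
    then show "(\<alpha> k)\<^sup>2 \<le> (\<Sum>k<n. \<alpha> k) * \<alpha> k" using a0 by (simp add: power2_eq_square mult_right_mono)
  qed
  also have "\<dots> = (LINT z|M_z. u z)\<^sup>2"
    using sum_over_cells[OF u n] by (simp add: \<alpha>_def power2_eq_square sum_distrib_left[symmetric])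
  finally have sa: "(\<Sum>k<n. (\<alpha> k)\<^sup>2) \<le> (LINT z|M_z. u z)\<^sup>2" .
  have "(LINT z|M_z. (v z)\<^sup>2) = (\<Sum>k<n. LINT z|M_z. ?J k z * (v z)\<^sup>2)"
    by (rule sum_over_cells[OF v2 n, symmetric])
  also have "\<dots> \<le> (\<Sum>k<n. 2 * (1 / real n)\<^sup>2 * (LINT z|M_z. ?J k z * (w z)\<^sup>2) + 648 / (1 / real n) ^ 3 * (\<alpha> k)\<^sup>2)"
  proof (rule sum_mono)
    fix k assume "k \<in> {..<n}"
    then have "real (Suc k) / real n \<le> 1" using n by simp
    moreover have "real (Suc k) / real n = real k / real n + 1 / real n"
      by (simp add: add_divide_distrib)
    ultimately have "-(1/2) + real k / real n + 1 / real n \<le> 1/2" by linarith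
    then show "(LINT z|M_z. ?J k z * (v z)\<^sup>2)
      \<le> 2 * (1 / real n)\<^sup>2 * (LINT z|M_z. ?J k z * (w z)\<^sup>2) + 648 / (1 / real n) ^ 3 * (\<alpha> k)\<^sup>2"
      unfolding \<alpha>_def using n
      by (intro cell_energy_bound[OF u v w v2 w2 nonneg rep_u rep_v]) auto
  qed
  also have "\<dots> = 2 * (1 / real n)\<^sup>2 * (\<Sum>k<n. LINT z|M_z. ?J k z * (w z)\<^sup>2) + 648 / (1 / real n) ^ 3 * (\<Sum>k<n. (\<alpha> k)\<^sup>2)"
    by (simp only: sum.distrib sum_distrib_left)
  also have "(\<Sum>k<n. LINT z|M_z. ?J k z * (w z)\<^sup>2) = (LINT z|M_z. (w z)\<^sup>2)"
    by (rule sum_over_cells[OF w2 n])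
  also have "2 * (1 / real n)\<^sup>2 * (LINT z|M_z. (w z)\<^sup>2) + 648 / (1 / real n) ^ 3 * (\<Sum>k<n. (\<alpha> k)\<^sup>2)
    \<le> 2 * (1 / real n)\<^sup>2 * (LINT z|M_z. (w z)\<^sup>2) + 648 / (1 / real n) ^ 3 * (LINT z|M_z. u z)\<^sup>2"
    using sa by (intro add_left_mono mult_left_mono) auto
  finally show ?thesis by (simp add: power_divide)
qed

section \<open>Uniform compression\<close>

lemma norm_sym_matrix: "(norm (sym_matrix a b c))\<^sup>2 = a\<^sup>2 + 2 * b\<^sup>2 + c\<^sup>2"
  unfolding sym_matrix_def
  by (simp add: norm_vec_def L2_set_def UNIV_2 vector_2 real_sqrt_pow2 sum_nonneg)

lemma zero_weak_deriv: "has_weak_deriv T i j (\<lambda>x. 0) (\<lambda>x. 0)"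
  by (simp add: has_weak_deriv_def)

lemma zero_H_per: "(\<lambda>x. 0) \<in> H_per k"
  unfolding H_per_def using const_L2[of 0] zero_weak_deriv by blast

lemma weak_deriv_zero: "AE x in Omega_measure. weak_deriv i j (\<lambda>x. 0) x = 0"
  by (rule weak_deriv_AE(2)[OF const_L2 zero_weak_deriv])

lemma snd_L2: "(snd :: real \<times> real \<Rightarrow> real) \<in> L2"
  by (intro continuous_L2 continuous_intros)

lemma linear_weak_derivs:
  "has_weak_deriv interior_tests 0 1 (\<lambda>x. c * snd x) (\<lambda>x. c)"
  "has_weak_deriv interior_tests 1 0 (\<lambda>x. c * snd x) (\<lambda>x. 0)"
  using has_weak_deriv_lincomb[OF zero_weak_deriv weak_deriv_snd_z const_L2 const_L2 snd_L2 const_L2, of c]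
    has_weak_deriv_lincomb[OF zero_weak_deriv weak_deriv_snd_theta const_L2 const_L2 snd_L2 const_L2, of c]
  by simp_all

lemma Linf_norm_le:
  assumes "g \<in> L2" "AE x in Omega_measure. \<bar>g x\<bar> \<le> c" "ereal c \<le> m"
  shows "Linf_norm g \<le> m"
proof -
  have "Linf_norm g \<le> ereal c"
    unfolding Linf_norm_def
  proof (rule esssup_I)
    have "g \<in> borel_measurable Omega_measure" using assms(1) by (simp add: L2_def)
    then show "(\<lambda>x. ereal \<bar>g x\<bar>) \<in> borel_measurable Omega_measure" by simp
    show "AE x in Omega_measure. ereal \<bar>g x\<bar> \<le> ereal c" using assms(2) by simp
  qed
  then show ?thesis using assms(3) by (rule order_trans)
qed

lemma min_energy_upper:
  assumes lam: "0 < lam" "lam \<le> 1/2" and m: "ereal 2 \<le> m"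
  shows "min_energy h lam 1 m \<le> ennreal 8 * ennreal (lam\<^sup>2)"
proof -
  define \<phi> :: displacement where "\<phi> x = vector [0, 0, - lam * snd x]" for x
  have c1: "comp_rho \<phi> = (\<lambda>x. 0)" and c2: "comp_theta \<phi> = (\<lambda>x. 0)" and c3: "comp_z \<phi> = (\<lambda>x. (- lam) * snd x)"
    by (simp_all add: \<phi>_def fun_eq_iff vector_3)
  have z0: "weak_deriv i j (\<lambda>x. 0) \<in> L2" for i j
    by (rule weak_deriv_AE(1)[OF const_L2 zero_weak_deriv])
  have Dz: "AE x in Omega_measure. D_z (\<lambda>x. (- lam) * snd x) x = - lam" "D_z (\<lambda>x. (- lam) * snd x) \<in> L2"
    and Dt: "AE x in Omega_measure. D_theta (\<lambda>x. (- lam) * snd x) x = 0" "D_theta (\<lambda>x. (- lam) * snd x) \<in> L2"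
    by (rule weak_deriv_AE[OF const_L2 linear_weak_derivs(1)] weak_deriv_AE[OF const_L2 linear_weak_derivs(2)])+
  have zb: "Linf_norm (weak_deriv i j (\<lambda>x. 0)) \<le> m" for i j
    by (rule Linf_norm_le[OF z0, of _ _ 2]) (use weak_deriv_zero[of i j] m in \<open>auto elim: eventually_mono\<close>)
  have "Linf_norm (D_theta (\<lambda>x. \<phi> x $ j)) \<le> m \<and> Linf_norm (D_z (\<lambda>x. \<phi> x $ j)) \<le> m" for j
  proof -
    consider "j = 1" | "j = 2" | "j = 3" using exhaust_3 by blast
    then show ?thesis
    proof cases
      case 1 then show ?thesis using zb c1 by simp
    next
      case 2 then show ?thesis using zb c2 by simp
    next
      case 3
      have "Linf_norm (D_theta (\<lambda>x. (- lam) * snd x)) \<le> m"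
        by (rule Linf_norm_le[OF Dt(2), of 2]) (use Dt(1) m in \<open>auto elim: eventually_mono\<close>)
      moreover have "Linf_norm (D_z (\<lambda>x. (- lam) * snd x)) \<le> m"
        by (rule Linf_norm_le[OF Dz(2), of 2]) (use Dz(1) m lam in \<open>auto elim!: eventually_mono\<close>)
      ultimately show ?thesis using 3 c3 by simp
    qed
  qed
  then have "\<phi> \<in> admissible lam 1 m"
    unfolding admissible_def using zero_H_per by (simp add: \<phi>_def)
  then have "min_energy h lam 1 m \<le> energy h \<phi>"
    unfolding min_energy_def by (rule INF_lower)
  also have "energy h \<phi> = (\<integral>\<^sup>+ x. ennreal (lam\<^sup>2) \<partial>Omega_measure)"
    unfolding energy_def
  proof (rule nn_integral_cong_AE)
    show "AE x in Omega_measure. ennreal ((norm (strain \<phi> x))\<^sup>2 + h\<^sup>2 * (norm (weak_hessian (comp_rho \<phi>) x))\<^sup>2) = ennreal (lam\<^sup>2)"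
      using Dz(1) Dt(1) weak_deriv_zero[of 1 0] weak_deriv_zero[of 0 1]
        weak_deriv_zero[of 2 0] weak_deriv_zero[of 1 1] weak_deriv_zero[of 0 2]
    proof eventually_elim
      case (elim x)
      then show ?case
        unfolding strain_def weak_hessian_def c1 c2 c3 norm_sym_matrix by (simp add: \<phi>_def)
    qed
  qed
  also have "\<dots> = ennreal (lam\<^sup>2) * ennreal (2 * pi)"
    by (simp add: space_Omega_measure emeasure_Omega)
  also have "\<dots> \<le> ennreal 8 * ennreal (lam\<^sup>2)"
    using pi_less_4 by (subst mult.commute) (intro mult_right_mono ennreal_leI, auto)
  finally show ?thesis .
qed

section \<open>The lower bound\<close>

text \<open>
  Extracts one component of the strain or of the Hessian from the energy.
\<close>

lemma square_integral_bound:
  fixes g :: "real \<times> real \<Rightarrow> real"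
  assumes g: "g \<in> borel_measurable Omega_measure"
    and le: "AE x in Omega_measure. (g x)\<^sup>2 \<le> S x"
    and S: "(\<integral>\<^sup>+ x. ennreal (S x) \<partial>Omega_measure) \<le> ennreal e" and e: "0 \<le> e"
  shows "integrable Omega_measure (\<lambda>x. (g x)\<^sup>2)" "(LINT x|Omega_measure. (g x)\<^sup>2) \<le> e"
proof -
  have "(\<integral>\<^sup>+ x. ennreal ((g x)\<^sup>2) \<partial>Omega_measure) \<le> (\<integral>\<^sup>+ x. ennreal (S x) \<partial>Omega_measure)"
    using le by (intro nn_integral_mono_AE) (auto elim!: eventually_mono intro: ennreal_leI)
  then have *: "(\<integral>\<^sup>+ x. ennreal ((g x)\<^sup>2) \<partial>Omega_measure) \<le> ennreal e" using S by (rule order_trans)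
  show i: "integrable Omega_measure (\<lambda>x. (g x)\<^sup>2)"
  proof (rule integrableI_nonneg)
    show "(\<integral>\<^sup>+ x. ennreal ((g x)\<^sup>2) \<partial>Omega_measure) < \<infinity>"
      using * by (rule le_less_trans) simp
  qed (use g in simp_all)
  show "(LINT x|Omega_measure. (g x)\<^sup>2) \<le> e"
    using * e by (subst (asm) nn_integral_eq_integral[OF i]) (auto simp: ennreal_le_iff)
qed

text \<open>
  Integrate \<open>2 * \<tau> * \<bar>g\<bar> \<le> g\<^sup>2 + \<tau>\<^sup>2\<close> over a domain of area \<open>2 * pi < 8\<close>.
\<close>

lemma abs_integral_bound:
  fixes g :: "real \<times> real \<Rightarrow> real"
  assumes g: "g \<in> borel_measurable Omega_measure" and g2: "integrable Omega_measure (\<lambda>x. (g x)\<^sup>2)"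
    and le: "(LINT x|Omega_measure. (g x)\<^sup>2) \<le> \<tau>\<^sup>2" and \<tau>: "0 < \<tau>"
  shows "integrable Omega_measure g" "(LINT x|Omega_measure. \<bar>g x\<bar>) \<le> 5 * \<tau>"
proof -
  interpret finite_measure Omega_measure by (rule finite_Omega_measure)
  show i: "integrable Omega_measure g"
  proof (rule L2_integrable)
    show "g \<in> L2" using g g2 by (simp add: L2_def)
  qed
  have "2 * \<tau> * \<bar>y\<bar> \<le> y\<^sup>2 + \<tau>\<^sup>2" for y
    using sum_squares_bound[of \<tau> "\<bar>y\<bar>"] by simp
  then have "(LINT x|Omega_measure. 2 * \<tau> * \<bar>g x\<bar>) \<le> (LINT x|Omega_measure. (g x)\<^sup>2 + \<tau>\<^sup>2)"
    using i g2 by (intro integral_mono) auto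
  also have "\<dots> \<le> \<tau>\<^sup>2 + 2 * pi * \<tau>\<^sup>2"
    using le g2 by (simp add: measure_def space_Omega_measure emeasure_Omega)
  also have "\<dots> \<le> 2 * \<tau> * (5 * \<tau>)"
    using pi_less_4 \<tau> mult_right_mono[of pi 4 "\<tau>\<^sup>2"] by (simp add: power2_eq_square)
  finally show "(LINT x|Omega_measure. \<bar>g x\<bar>) \<le> 5 * \<tau>" using \<tau> by simp
qed

lemma interior_weak_deriv_tensor:
  assumes "has_weak_deriv interior_tests 0 1 f g" "a \<in> tests1 0 (2 * pi)" "b \<in> tests1 (-(1/2)) (1/2)"
  shows "(LINT x|Omega_measure. f x * tensor a (deriv b) x) = - (LINT x|Omega_measure. g x * tensor a b x)"
proof -
  have "pd 0 1 (tensor a b) = tensor a (deriv b)"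
    using pd_tensor[of a b 0 1] assms tests1_smooth1 by simp
  then show ?thesis
    using assms tensor_interior_tests[of a b] unfolding has_weak_deriv_def by fastforce
qed

text \<open>
  The second axial derivative of \<open>u\<close> is the first one of \<open>v\<close>: use the derivative of a test as a test.
\<close>

lemma second_weak_deriv_tensor:
  assumes uv: "has_weak_deriv interior_tests 0 1 u v" and uw: "has_weak_deriv interior_tests 0 2 u w"
    and a: "a \<in> tests1 0 (2 * pi)" and b: "b \<in> tests1 (-(1/2)) (1/2)"
  shows "(LINT x|Omega_measure. v x * tensor a (deriv b) x) = - (LINT x|Omega_measure. w x * tensor a b x)"
proof -
  have "pd 0 2 (tensor a b) = tensor a (deriv (deriv b))"
    using pd_tensor[of a b 0 2] a b tests1_smooth1 by (simp add: numeral_2_eq_2)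
  then have "(LINT x|Omega_measure. u x * tensor a (deriv (deriv b)) x) = (LINT x|Omega_measure. w x * tensor a b x)"
    using uw tensor_interior_tests[OF a b] unfolding has_weak_deriv_def by fastforce
  then show ?thesis
    using interior_weak_deriv_tensor[OF uv a tests1_deriv[OF b]] by simp
qed

text \<open>
  With \<open>y = h powr (-2/5)\<close> and \<open>y \<le> n \<le> 2 * y\<close>, both bounds reduce to
  \<open>y ^ 3 = h powr (-6/5) \<le> 1 / lam\<close>, the second one directly and the first one because
  \<open>y ^ 5 = 1 / h\<^sup>2\<close>.
\<close>

lemma scale_choice:
  assumes h: "0 < h" "h \<le> 1/2" and lam: "0 < lam" and hl: "h \<ge> lam powr (5/6)"
  shows "\<exists>n>0::nat. 1 / (real n)\<^sup>2 \<le> h\<^sup>2 / lam \<and> real n ^ 3 \<le> 8 / lam"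
proof -
  define y where "y = h powr (-2/5)"
  have y1: "1 \<le> y"
    using powr_mono'[of "-2/5" 0 h] h by (simp add: y_def)
  have y3: "y ^ 3 \<le> 1 / lam"
  proof -
    have "lam = (lam powr (5/6)) powr (6/5)" using lam by (simp add: powr_powr)
    also have "\<dots> \<le> h powr (6/5)" using hl by (intro powr_mono2) auto
    finally have "1 / h powr (6/5) \<le> 1 / lam" using lam h by (intro divide_left_mono) auto
    moreover have "y ^ 3 = 1 / h powr (6/5)"
    proof -
      have "y ^ 3 = h powr (- (6/5))" using h by (simp add: y_def powr_power)
      then show ?thesis by (simp only: powr_minus_divide)
    qed
    ultimately show ?thesis by simp
  qed
  have y5: "y ^ 5 = 1 / h\<^sup>2"
  proof -
    have "y ^ 5 = h powr (- 2)" using h by (simp add: y_def powr_power)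
    then show ?thesis using h by (simp only: powr_minus_divide) simp
  qed
  define n where "n = nat \<lceil>y\<rceil>"
  have n: "y \<le> real n" "real n \<le> 2 * y" "0 < n" using y1 unfolding n_def by linarith+
  have "1 / (real n)\<^sup>2 \<le> 1 / y\<^sup>2" using n y1 by (intro divide_left_mono power_mono) auto
  also have "1 / y\<^sup>2 = y ^ 3 * h\<^sup>2"
  proof -
    have "y ^ 3 * y\<^sup>2 * h\<^sup>2 = 1" using y5 h by (simp flip: power_add)
    then show ?thesis using y1 by (simp add: field_simps)
  qed
  also have "\<dots> \<le> h\<^sup>2 / lam" using mult_right_mono[OF y3, of "h\<^sup>2"] by simp
  finally have A: "1 / (real n)\<^sup>2 \<le> h\<^sup>2 / lam" .
  have "real n ^ 3 \<le> (2 * y) ^ 3" using n by (intro power_mono) auto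
  also have "\<dots> \<le> 8 / lam" using y3 by (simp add: power_mult_distrib)
  finally show ?thesis using A n by blast
qed

text \<open>
  Collects what membership in the admissible set provides. The function \<open>p\<close> has integral zero by
  testing with the constant \<open>1\<close>, and the axial displacement inherits its derivative from the periodic
  function \<open>\<phi>\<^sub>z + lam * z\<close>.
\<close>

lemma admissibleE:
  assumes "\<phi> \<in> admissible lam 1 m"
  obtains u v w p q where "comp_rho \<phi> = u" "u \<in> L2" "v \<in> L2" "w \<in> L2" "p \<in> L2" "q \<in> L2"
    "AE x in Omega_measure. 0 \<le> u x"
    "has_weak_deriv interior_tests 0 1 u v" "has_weak_deriv interior_tests 0 2 u w"
    "AE x in Omega_measure. D_z u x = v x" "AE x in Omega_measure. weak_deriv 0 2 u x = w x"
    "AE x in Omega_measure. D_theta (comp_theta \<phi>) x = p x" "(LINT x|Omega_measure. p x) = 0"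
    "AE x in Omega_measure. D_z (comp_z \<phi>) x = q x - lam" "AE \<theta> in M_theta. (LINT z|M_z. q (\<theta>, z)) = 0"
proof -
  let ?u = "comp_rho \<phi>" and ?f = "\<lambda>x. comp_z \<phi> x + lam * snd x"
  have adm: "?u \<in> H_per 2" "comp_theta \<phi> \<in> H_per 1" "?f \<in> H_per 1"
    and nonneg: "AE x in Omega_measure. 0 \<le> ?u x"
    using assms by (simp_all add: admissible_def)
  have u: "?u \<in> L2" and f: "?f \<in> L2" and t: "comp_theta \<phi> \<in> L2"
    using adm by (simp_all add: H_per_def)
  have ex: "\<exists>g\<in>L2. has_weak_deriv per_tests i j f g" if "f \<in> H_per k" "i + j \<le> k" for f i j k
    using that unfolding H_per_def by blast
  obtain v where v: "v \<in> L2" "has_weak_deriv per_tests 0 1 ?u v" using ex[OF adm(1), of 0 1] by auto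
  obtain w where w: "w \<in> L2" "has_weak_deriv per_tests 0 2 ?u w" using ex[OF adm(1), of 0 2] by auto
  obtain p where p: "p \<in> L2" "has_weak_deriv per_tests 1 0 (comp_theta \<phi>) p" using ex[OF adm(2), of 1 0] by auto
  obtain q where q: "q \<in> L2" "has_weak_deriv per_tests 0 1 ?f q" using ex[OF adm(3), of 0 1] by auto
  note vi = per_weak_deriv_imp_interior[OF v(2) u v(1)]
  note wi = per_weak_deriv_imp_interior[OF w(2) u w(1)]
  note pi = per_weak_deriv_imp_interior[OF p(2) t p(1)]
  note qi = per_weak_deriv_imp_interior[OF q(2) f q(1)]
  have one: "(\<lambda>x. 1) \<in> per_tests"
    using smooth_tensor[OF smooth1_const[of 1] smooth1_const[of 1]]
    by (simp add: per_tests_def Omega_periodic_def tensor_def case_prod_beta')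
  have p0: "(LINT x|Omega_measure. p x) = 0"
  proof -
    have "pd 1 0 (\<lambda>x. 1) = (\<lambda>x. 0)" by (auto simp: pd_def pd_theta_def)
    then show ?thesis using p(2) one unfolding has_weak_deriv_def by fastforce
  qed
  have "has_weak_deriv interior_tests 0 1 (\<lambda>x. ?f x + (- lam) * snd x) (\<lambda>x. q x + (- lam) * 1)"
    by (rule has_weak_deriv_lincomb[OF qi weak_deriv_snd_z f q(1) snd_L2 const_L2])
  then have zi: "has_weak_deriv interior_tests 0 1 (comp_z \<phi>) (\<lambda>x. q x - lam)" by simp
  have ql: "(\<lambda>x. q x - lam) \<in> L2" using L2_add[OF q(1) const_L2[of "- lam"]] by simp
  show ?thesis
    by (rule that[OF refl u v(1) w(1) p(1) q(1) nonneg vi wi weak_deriv_AE(2)[OF v(1) vi]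
          weak_deriv_AE(2)[OF w(1) wi] weak_deriv_AE(2)[OF p(1) pi] p0 weak_deriv_AE(2)[OF ql zi]
          periodic_z_deriv_mean_zero[OF q]])
qed

lemma slicewise_interpolation:
  assumes L: "u \<in> L2" "v \<in> L2" "w \<in> L2" and nonneg: "AE x in Omega_measure. 0 \<le> u x"
    and uv: "has_weak_deriv interior_tests 0 1 u v" and uw: "has_weak_deriv interior_tests 0 2 u w"
    and n: "0 < n"
  shows "AE \<theta> in M_theta. (LINT z|M_z. (v (\<theta>, z))\<^sup>2) \<le>
    2 / (real n)\<^sup>2 * (LINT z|M_z. (w (\<theta>, z))\<^sup>2) + 648 * real n ^ 3 * (LINT z|M_z. u (\<theta>, z))\<^sup>2"
proof -
  have sq: "integrable Omega_measure (\<lambda>x. (v x)\<^sup>2)" "integrable Omega_measure (\<lambda>x. (w x)\<^sup>2)"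
    using L by (simp_all add: L2_def)
  note int = AE_slice_integrable[OF L2_integrable[OF L(1)]] AE_slice_integrable[OF L2_integrable[OF L(2)]]
    AE_slice_integrable[OF L2_integrable[OF L(3)]] AE_slice_integrable[OF sq(1)] AE_slice_integrable[OF sq(2)]
  have rep: "AE \<theta> in M_theta. \<exists>c. AE z in M_z. u (\<theta>, z) = c + (LINT s|M_z. indicator {..z} s * v (\<theta>, s))"
    "AE \<theta> in M_theta. \<exists>d. AE z in M_z. v (\<theta>, z) = d + (LINT s|M_z. indicator {..z} s * w (\<theta>, s))"
    using slice_representation[OF L(1,2)] interior_weak_deriv_tensor[OF uv]
      slice_representation[OF L(2,3)] second_weak_deriv_tensor[OF uv uw] by blast+
  show ?thesis
    using int AE_slices[OF nonneg] rep
  proof eventually_elim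
    case (elim \<theta>)
    from elim(7) obtain c where c: "AE z in M_z. u (\<theta>, z) = c + (LINT s|M_z. indicator {..z} s * v (\<theta>, s))" by blast
    from elim(8) obtain d where d: "AE z in M_z. v (\<theta>, z) = d + (LINT s|M_z. indicator {..z} s * w (\<theta>, s))" by blast
    show ?case by (rule slice_interpolation[OF elim(1-6) c d n])
  qed
qed

text \<open>
  The contradiction sketched at the beginning. The restriction to slices with small integral \<open>f\<close> of
  \<open>u\<close> is built into the factor \<open>1 - f \<theta> / (5 * \<tau>)\<close> of the slicewise inequality \<open>key\<close>: it is at
  most \<open>1\<close>, it is negative on the other slices, and its integral is at least \<open>2 * pi - 1\<close>.
\<close>

lemma energy_lower:
  assumes h: "0 < h" "h \<le> 1/2" and lam: "0 < lam" and hl: "h \<ge> lam powr (5/6)"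
    and adm: "\<phi> \<in> admissible lam 1 m"
  shows "ennreal ((lam / 1000)\<^sup>2) \<le> energy h \<phi>"
proof (rule ccontr)
  assume neg: "\<not> ?thesis"
  define \<tau> where "\<tau> = lam / 1000"
  have \<tau>: "0 < \<tau>" using lam by (simp add: \<tau>_def)
  have E: "energy h \<phi> \<le> ennreal (\<tau>\<^sup>2)" using neg by (simp add: \<tau>_def)
  obtain u v w p q where rho: "comp_rho \<phi> = u"
    and L: "u \<in> L2" "v \<in> L2" "w \<in> L2" "p \<in> L2" "q \<in> L2"
    and nonneg: "AE x in Omega_measure. 0 \<le> u x"
    and wd: "has_weak_deriv interior_tests 0 1 u v" "has_weak_deriv interior_tests 0 2 u w"
    and AE: "AE x in Omega_measure. D_z u x = v x" "AE x in Omega_measure. weak_deriv 0 2 u x = w x"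
      "AE x in Omega_measure. D_theta (comp_theta \<phi>) x = p x" "AE x in Omega_measure. D_z (comp_z \<phi>) x = q x - lam"
    and p0: "(LINT x|Omega_measure. p x) = 0" and q0: "AE \<theta> in M_theta. (LINT z|M_z. q (\<theta>, z)) = 0"
    by (rule admissibleE[OF adm])
  have meas [measurable]: "u \<in> borel_measurable Omega_measure" "v \<in> borel_measurable Omega_measure"
      "w \<in> borel_measurable Omega_measure" "p \<in> borel_measurable Omega_measure" "q \<in> borel_measurable Omega_measure"
    using L by (simp_all add: L2_def)
  note int = L2_integrable[OF L(1)] L2_integrable[OF L(2)] L2_integrable[OF L(3)] L2_integrable[OF L(4)] L2_integrable[OF L(5)]
  have sq: "integrable Omega_measure (\<lambda>x. (v x)\<^sup>2)" "integrable Omega_measure (\<lambda>x. (w x)\<^sup>2)"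
    using L by (simp_all add: L2_def)
  define S where "S x = (norm (strain \<phi> x))\<^sup>2 + h\<^sup>2 * (norm (weak_hessian (comp_rho \<phi>) x))\<^sup>2" for x
  have SE: "(\<integral>\<^sup>+ x. ennreal (S x) \<partial>Omega_measure) \<le> ennreal (\<tau>\<^sup>2)"
    using E by (simp add: S_def energy_def)
  \<comment> \<open>The positive part is used because the omitted square of \<open>D_theta u\<close> only increases the strain.\<close>
  define g1 where "g1 x = max 0 (p x + u x)" for x
  define g2 where "g2 x = q x - lam + 1/2 * (v x)\<^sup>2" for x
  have "AE x in Omega_measure. (g1 x)\<^sup>2 \<le> S x \<and> (g2 x)\<^sup>2 \<le> S x \<and> (h * w x)\<^sup>2 \<le> S x"
    using AE
  proof eventually_elim
    case (elim x)
    define A where "A = p x + 1/2 * (D_theta u x)\<^sup>2 + u x"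
    define B where "B = 1/2 * (D_theta (comp_z \<phi>) x + D_z (comp_theta \<phi>) x) + 1/2 * D_theta u x * v x"
    have ux: "\<phi> x $ 1 = u x" using rho by metis
    have S: "S x = A\<^sup>2 + 2 * B\<^sup>2 + (g2 x)\<^sup>2 + h\<^sup>2 * ((weak_deriv 2 0 u x)\<^sup>2 + 2 * (weak_deriv 1 1 u x)\<^sup>2 + (w x)\<^sup>2)"
      unfolding S_def strain_def weak_hessian_def norm_sym_matrix rho ux elim A_def B_def g2_def by simp
    have "g1 x \<le> \<bar>A\<bar>" unfolding g1_def A_def using zero_le_power2[of "D_theta u x"] by linarith
    then have "(g1 x)\<^sup>2 \<le> A\<^sup>2" using power_mono[of "g1 x" "\<bar>A\<bar>" 2] by (simp add: g1_def)
    moreover define H where "H = h\<^sup>2 * ((weak_deriv 2 0 u x)\<^sup>2 + 2 * (weak_deriv 1 1 u x)\<^sup>2)"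
    moreover have "S x = A\<^sup>2 + 2 * B\<^sup>2 + (g2 x)\<^sup>2 + (H + (h * w x)\<^sup>2)"
      unfolding S H_def by (simp add: power_mult_distrib distrib_left)
    moreover have "0 \<le> H" "0 \<le> A\<^sup>2" "0 \<le> B\<^sup>2" "0 \<le> (g2 x)\<^sup>2" "0 \<le> (h * w x)\<^sup>2" by (simp_all add: H_def)
    ultimately show ?case by linarith
  qed
  then have le: "AE x in Omega_measure. (g1 x)\<^sup>2 \<le> S x" "AE x in Omega_measure. (g2 x)\<^sup>2 \<le> S x"
    "AE x in Omega_measure. (h * w x)\<^sup>2 \<le> S x"
    by (auto elim: eventually_mono)
  have gm: "g1 \<in> borel_measurable Omega_measure" "g2 \<in> borel_measurable Omega_measure"
    "(\<lambda>x. h * w x) \<in> borel_measurable Omega_measure"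
    unfolding g1_def[abs_def] g2_def[abs_def] by measurable
  note b1 = square_integral_bound[OF gm(1) le(1) SE] and b2 = square_integral_bound[OF gm(2) le(2) SE]
    and b3 = square_integral_bound[OF gm(3) le(3) SE]
  note a1 = abs_integral_bound[OF gm(1) b1 \<tau>] and a2 = abs_integral_bound[OF gm(2) b2 \<tau>]
  define A where "A = (LINT x|Omega_measure. u x)"
  \<comment> \<open>Hoop strain: \<open>p\<close> has integral zero, so the integral of \<open>u\<close> is at most that of the positive part of \<open>p + u\<close>.\<close>
  have A: "A \<le> 5 * \<tau>"
  proof -
    have "A = (LINT x|Omega_measure. p x + u x)" using int p0 by (simp add: A_def)
    also have "\<dots> \<le> (LINT x|Omega_measure. \<bar>g1 x\<bar>)"
      using int a1 by (intro integral_mono) (auto simp: g1_def)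
    finally show ?thesis using a1 by simp
  qed
  have W: "(LINT x|Omega_measure. (w x)\<^sup>2) \<le> \<tau>\<^sup>2 / h\<^sup>2"
    using b3(2) h by (simp add: power_mult_distrib field_simps)
  define f where "f \<theta> = (LINT z|M_z. u (\<theta>, z))" for \<theta>
  define V where "V \<theta> = (LINT z|M_z. (v (\<theta>, z))\<^sup>2)" for \<theta>
  define Wz where "Wz \<theta> = (LINT z|M_z. (w (\<theta>, z))\<^sup>2)" for \<theta>
  define R where "R \<theta> = (LINT z|M_z. \<bar>g2 (\<theta>, z)\<bar>)" for \<theta>
  obtain n where n: "0 < n" "1 / (real n)\<^sup>2 \<le> h\<^sup>2 / lam" "real n ^ 3 \<le> 8 / lam"
    using scale_choice[OF h lam hl] by blast
  have iR: "integrable Omega_measure (\<lambda>x. \<bar>g2 x\<bar>)" using a2 by simp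
  have fi: "integrable M_theta f" "integrable M_theta Wz" "integrable M_theta R"
    unfolding f_def[abs_def] Wz_def[abs_def] R_def[abs_def]
    by (rule integrable_slice_integral int sq iR)+
  have tot: "(LINT \<theta>|M_theta. f \<theta>) = A" "(LINT \<theta>|M_theta. Wz \<theta>) = (LINT x|Omega_measure. (w x)\<^sup>2)"
    "(LINT \<theta>|M_theta. R \<theta>) = (LINT x|Omega_measure. \<bar>g2 x\<bar>)"
    unfolding f_def Wz_def R_def A_def
    by (rule integral_Omega_iterated[symmetric] int sq iR)+
  have key: "AE \<theta> in M_theta. 2 * lam * (1 - f \<theta> / (5 * \<tau>))
      \<le> 2 / (real n)\<^sup>2 * Wz \<theta> + 648 * real n ^ 3 * (5 * \<tau> * f \<theta>) + 2 * R \<theta>"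
    using slicewise_interpolation[OF L(1,2,3) nonneg wd n(1)] AE_slices[OF nonneg] q0
      AE_slice_integrable[OF int(5)] AE_slice_integrable[OF sq(1)]
  proof eventually_elim
    case (elim \<theta>)
    interpret z: prob_space M_z by (rule prob_space_M_z)
    have f0: "0 \<le> f \<theta>" unfolding f_def using elim(2) by (rule integral_nonneg_AE)
    have W0: "0 \<le> Wz \<theta>" "0 \<le> R \<theta>" by (auto simp: Wz_def R_def intro!: integral_nonneg_AE)
    have nn: "0 \<le> 2 / (real n)\<^sup>2 * Wz \<theta>" "0 \<le> 648 * real n ^ 3 * (5 * \<tau> * f \<theta>)"
      using W0 f0 \<tau> by simp_all
    show ?case
    proof (cases "f \<theta> \<le> 5 * \<tau>")
      case True
      \<comment> \<open>Axial strain: its mean is \<open>- lam\<close> plus the stretching produced by the slopes of \<open>u\<close>.\<close>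
      have "(LINT z|M_z. g2 (\<theta>, z)) = - lam + V \<theta> / 2"
        using elim(3-5) by (simp add: g2_def V_def measure_restrict_space)
      moreover have "\<bar>LINT z|M_z. g2 (\<theta>, z)\<bar> \<le> R \<theta>" unfolding R_def by (rule integral_abs_bound)
      ultimately have "2 * lam \<le> V \<theta> + 2 * R \<theta>" by linarith
      also have "V \<theta> \<le> 2 / (real n)\<^sup>2 * Wz \<theta> + 648 * real n ^ 3 * (f \<theta>)\<^sup>2"
        using elim(1) by (simp add: V_def Wz_def f_def)
      also have "648 * real n ^ 3 * (f \<theta>)\<^sup>2 \<le> 648 * real n ^ 3 * (5 * \<tau> * f \<theta>)"
        using True f0 by (intro mult_left_mono) (auto simp: power2_eq_square mult_right_mono)
      finally have "2 * lam \<le> 2 / (real n)\<^sup>2 * Wz \<theta> + 648 * real n ^ 3 * (5 * \<tau> * f \<theta>) + 2 * R \<theta>" by simp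
      moreover have "2 * lam * (1 - f \<theta> / (5 * \<tau>)) \<le> 2 * lam"
        using lam f0 \<tau> by (simp add: mult_left_le)
      ultimately show ?thesis by linarith
    next
      case False
      then have "1 - f \<theta> / (5 * \<tau>) \<le> 0" using \<tau> by (simp add: field_simps)
      then have "2 * lam * (1 - f \<theta> / (5 * \<tau>)) \<le> 0" using lam by (simp add: mult_nonneg_nonpos)
      then show ?thesis using nn W0 by linarith
    qed
  qed
  interpret t: finite_measure M_theta by (rule finite_M_theta)
  have "(LINT \<theta>|M_theta. 2 * lam * (1 - f \<theta> / (5 * \<tau>)))
    \<le> (LINT \<theta>|M_theta. 2 / (real n)\<^sup>2 * Wz \<theta> + 648 * real n ^ 3 * (5 * \<tau> * f \<theta>) + 2 * R \<theta>)"
    using fi by (intro integral_mono_AE key) simp_all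
  also have "\<dots> = 2 / (real n)\<^sup>2 * (LINT x|Omega_measure. (w x)\<^sup>2) + 648 * real n ^ 3 * (5 * \<tau> * A)
      + 2 * (LINT x|Omega_measure. \<bar>g2 x\<bar>)"
    using fi tot by simp
  also have "(LINT \<theta>|M_theta. 2 * lam * (1 - f \<theta> / (5 * \<tau>))) = 2 * lam * (2 * pi - A / (5 * \<tau>))"
    using fi tot by (simp add: measure_restrict_space)
  finally have main: "2 * lam * (2 * pi - A / (5 * \<tau>))
    \<le> 2 / (real n)\<^sup>2 * (LINT x|Omega_measure. (w x)\<^sup>2) + 648 * real n ^ 3 * (5 * \<tau> * A)
      + 2 * (LINT x|Omega_measure. \<bar>g2 x\<bar>)" .
  have "A / (5 * \<tau>) \<le> 1" using A \<tau> by simp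
  then have "2 * lam * 3 \<le> 2 * lam * (2 * pi - A / (5 * \<tau>))"
    using lam pi_ge_two by (intro mult_left_mono) auto
  moreover have "2 / (real n)\<^sup>2 * (LINT x|Omega_measure. (w x)\<^sup>2) \<le> 2 * (h\<^sup>2 / lam) * (\<tau>\<^sup>2 / h\<^sup>2)"
    using n(2) W lam by (intro mult_mono) auto
  moreover have "\<dots> = 2 * \<tau>\<^sup>2 / lam" using h by simp
  moreover have "648 * real n ^ 3 * (5 * \<tau> * A) \<le> 648 * (8 / lam) * (5 * \<tau> * (5 * \<tau>))"
  proof -
    have "0 \<le> A" unfolding A_def using nonneg by (rule integral_nonneg_AE)
    then show ?thesis using n(3) A \<tau> lam by (intro mult_mono) auto
  qed
  moreover have "2 * (LINT x|Omega_measure. \<bar>g2 x\<bar>) \<le> 10 * \<tau>" using a2(2) by simp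
  ultimately have "6 * lam \<le> 2 * \<tau>\<^sup>2 / lam + 648 * (8 / lam) * (5 * \<tau> * (5 * \<tau>)) + 10 * \<tau>"
    using main by linarith
  also have "\<dots> = (2 / 10 ^ 6 + 648 * 200 / 10 ^ 6 + 1 / 100) * lam"
    using lam by (simp add: \<tau>_def power2_eq_square field_simps)
  also have "\<dots> < 6 * lam" using lam by simp
  finally show False by simp
qed

lemma min_energy_lower:
  assumes "0 < h" "h \<le> 1/2" "0 < lam" "h \<ge> lam powr (5/6)"
  shows "ennreal (lam\<^sup>2) \<le> ennreal (10 ^ 6) * min_energy h lam 1 m"
proof -
  have "ennreal ((lam / 1000)\<^sup>2) \<le> min_energy h lam 1 m"
    unfolding min_energy_def by (rule INF_greatest) (rule energy_lower[OF assms])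
  then have "ennreal (10 ^ 6) * ennreal ((lam / 1000)\<^sup>2) \<le> ennreal (10 ^ 6) * min_energy h lam 1 m"
    by (intro mult_left_mono) auto
  moreover have "ennreal (10 ^ 6) * ennreal ((lam / 1000)\<^sup>2) = ennreal (10 ^ 6 * (lam / 1000)\<^sup>2)"
    by (rule ennreal_mult[symmetric]) auto
  moreover have "10 ^ 6 * (lam / 1000)\<^sup>2 = lam\<^sup>2" by (simp add: power_divide)
  ultimately show ?thesis by simp
qed

theorem corollary1p7:
  shows "(\<forall>m::real. m \<ge> 2 \<longrightarrow>
      (\<exists>C1>0. \<exists>C2>0. \<forall>h lam :: real.
         0 < h \<and> h \<le> 1/2 \<and> 0 < lam \<and> lam \<le> 1/2 \<and> h \<ge> lam powr (5/6) \<longrightarrow>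
           min_energy h lam 1 (ereal m) \<le> ennreal C1 * ennreal (lam\<^sup>2) \<and>
           ennreal (lam\<^sup>2) \<le> ennreal C2 * min_energy h lam 1 (ereal m)))
    \<and> (\<exists>C1>0. \<exists>C2>0. \<forall>h lam :: real.
         0 < h \<and> h \<le> 1/2 \<and> 0 < lam \<and> lam \<le> 1/2 \<and> h \<ge> lam powr (5/6) \<longrightarrow>
           min_energy h lam 1 \<infinity> \<le> ennreal C1 * ennreal (lam\<^sup>2) \<and>
           ennreal (lam\<^sup>2) \<le> ennreal C2 * min_energy h lam 1 \<infinity>)"
proof -
  have "min_energy h lam 1 m \<le> ennreal 8 * ennreal (lam\<^sup>2) \<and>
      ennreal (lam\<^sup>2) \<le> ennreal (10 ^ 6) * min_energy h lam 1 m"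
    if "ereal 2 \<le> m" "0 < h \<and> h \<le> 1/2 \<and> 0 < lam \<and> lam \<le> 1/2 \<and> h \<ge> lam powr (5/6)" for h lam :: real and m
    using that min_energy_upper[of lam m h] min_energy_lower[of h lam m] by blast
  then show ?thesis
    by (intro conjI allI impI exI[of _ "8::real"] exI[of _ "10 ^ 6 :: real"]) simp_all
qed

end
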